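(* Let $n\ge 2$ and $1\le k\le n-1$ be integers. The linear span of the mixed volumes $K\mapsto V(K[k],L_1,\dots,L_{n-k})$, where $L_1,\dots,L_{n-k}$ range over all convex bodies in $\mathcal{K}(\mathbb{R}^n)$, is a proper subspace of $\mathrm{Val}_k(\mathbb{R}^n)$.
   Context: $\mathcal{K}(\mathbb{R}^n)$ is the set of all non-empty compact convex subsets of $\mathbb{R}^n$ (convex bodies) with the Hausdorff metric. A map $\mu:\mathcal{K}(\mathbb{R}^n)\to\mathbb{R}$ is a valuation if $\mu(K)+\mu(L)=\mu(K\cup L)+\mu(K\cap L)$ for all $K,L\in\mathcal{K}(\mathbb{R}^n)$ with $K\cup L$ convex. $\mathrm{Val}_k(\mathbb{R}^n)$ is the space of all valuations on $\mathcal{K}(\mathbb{R}^n)$ that are continuous (with respect to the Hausdorff metric), translation invariant, and $k$-homogeneous, i.e. $\mu(tK)=t^k\mu(K)$ for all $t\ge 0$ and $K\in\mathcal{K}(\mathbb{R}^n)$. Linear span means the set of finite real linear combinations. The mixed volume $V(K_1,\dots,K_n)$ of $K_1,\dots,K_n\in\mathcal{K}(\mathbb{R}^n)$ is the functional, symmetric in its arguments, determined by $$\mathrm{vol}_n(\lambda_1K_1+\dots+\lambda_nK_n)=\sum_{i_1,\dots,i_n=1}^n\lambda_{i_1}\cdots\lambda_{i_n}V(K_{i_1},\dots,K_{i_n}),\qquad \lambda_1,\dots,\lambda_n\ge 0,$$ where $\mathrm{vol}_n$ is Lebesgue measure. The notation $K[k]$ means that the argument $K$ is repeated $k$ times. 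*)

theory Defs
  imports "HOL-Analysis.Analysis" "HOL-Library.Function_Algebras" "HOL-Library.Multiset"
begin

section \<open>Real-valued functions as a real vector space\<close>

text \<open>Pointwise scalar multiplication; pointwise addition comes from
  \<^theory>\<open>HOL-Library.Function_Algebras\<close>.\<close>

instantiation "fun" :: (type, real_vector) real_vector
begin

definition scaleR_fun_def: "c *\<^sub>R f = (\<lambda>x. c *\<^sub>R f x)"

instance
  by standard (simp_all add: scaleR_fun_def fun_eq_iff scaleR_add_right scaleR_add_left)

end


section \<open>Convex bodies\<close>

typedef (overloaded) ('a::euclidean_space) convex_body =
  "{K :: 'a set. K \<noteq> {} \<and> compact K \<and> convex K}"
  morphisms body_set Body
  by (rule exI[of _ "{0}"]) simp

setup_lifting type_definition_convex_body

lemma body_set_nonempty: "body_set K \<noteq> {}"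
  and body_set_compact: "compact (body_set K)"
  and body_set_convex: "convex (body_set K)"
  using body_set[of K] by auto

text \<open>Minkowski sum and dilation. The neutral element of the sum is the body consisting of
  the origin only.\<close>

instantiation convex_body :: (euclidean_space) "{comm_monoid_add, scaleR}"
begin

lift_definition zero_convex_body :: "'a convex_body" is "{0}"
  by simp

lift_definition plus_convex_body :: "'a convex_body \<Rightarrow> 'a convex_body \<Rightarrow> 'a convex_body"
  is "\<lambda>K L. {x + y | x y. x \<in> K \<and> y \<in> L}"
proof -
  fix K L :: "'a set"
  assume "K \<noteq> {} \<and> compact K \<and> convex K" and "L \<noteq> {} \<and> compact L \<and> convex L"
  moreover have "{x + y | x y. x \<in> K \<and> y \<in> L} = (\<Union>x\<in>K. \<Union>y\<in>L. {x + y})"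
    by auto
  ultimately show "{x + y | x y. x \<in> K \<and> y \<in> L} \<noteq> {} \<and> compact {x + y | x y. x \<in> K \<and> y \<in> L}
      \<and> convex {x + y | x y. x \<in> K \<and> y \<in> L}"
    using compact_sums[of K L] convex_sums[of K L] by auto
qed

lift_definition scaleR_convex_body :: "real \<Rightarrow> 'a convex_body \<Rightarrow> 'a convex_body"
  is "\<lambda>t K. (\<lambda>x. t *\<^sub>R x) ` K"
  by (auto intro: compact_scaling convex_scaling)

instance
proof
  fix A B C :: "'a convex_body"
  show "A + B + C = A + (B + C)"
    by transfer (auto, (metis add.assoc)+)
  show "A + B = B + A"
    by transfer (auto, (metis add.commute)+)
  show "0 + A = A"
    by transfer auto
qed

end

lift_definition body_translate :: "'a::euclidean_space \<Rightarrow> 'a convex_body \<Rightarrow> 'a convex_body"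
  is "\<lambda>a K. (\<lambda>x. a + x) ` K"
  by (auto intro: compact_translation convex_translation)


section \<open>The Hausdorff metric\<close>

definition hausdorff_dist :: "'a::metric_space set \<Rightarrow> 'a set \<Rightarrow> real" where
  "hausdorff_dist K L = max (SUP x\<in>K. infdist x L) (SUP y\<in>L. infdist y K)"

lemma hausdorff_dist_le_iff:
  fixes K L :: "'a::metric_space set"
  assumes "K \<noteq> {}" "compact K" "L \<noteq> {}" "compact L"
  shows "hausdorff_dist K L \<le> e \<longleftrightarrow> (\<forall>x\<in>K. infdist x L \<le> e) \<and> (\<forall>y\<in>L. infdist y K \<le> e)"
proof -
  have bdd: "bdd_above ((\<lambda>x. infdist x B) ` A)" if "compact A" for A B :: "'a set"
    by (intro bounded_imp_bdd_above compact_imp_bounded compact_continuous_image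
        continuous_intros that)
  show ?thesis
    using assms by (simp add: hausdorff_dist_def cSUP_le_iff bdd)
qed

instantiation convex_body :: (euclidean_space) metric_space
begin

definition dist_convex_body :: "'a convex_body \<Rightarrow> 'a convex_body \<Rightarrow> real" where
  "dist_convex_body K L = hausdorff_dist (body_set K) (body_set L)"

definition uniformity_convex_body :: "('a convex_body \<times> 'a convex_body) filter" where
  "uniformity_convex_body = (INF e\<in>{0<..}. principal {(K, L). dist K L < e})"

definition open_convex_body :: "'a convex_body set \<Rightarrow> bool" where
  "open_convex_body U \<longleftrightarrow> (\<forall>K\<in>U. \<forall>\<^sub>F (K', L) in uniformity. K' = K \<longrightarrow> L \<in> U)"

instance
proof
  fix K L M :: "'a convex_body"
  have le_iff: "dist A B \<le> e \<longleftrightarrow> (\<forall>x\<in>body_set A. infdist x (body_set B) \<le> e)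
      \<and> (\<forall>y\<in>body_set B. infdist y (body_set A) \<le> e)" for A B :: "'a convex_body" and e
    unfolding dist_convex_body_def
    by (intro hausdorff_dist_le_iff body_set_nonempty body_set_compact)
  show "dist K L = 0 \<longleftrightarrow> K = L"
  proof
    assume "dist K L = 0"
    then have "\<forall>x\<in>body_set K. infdist x (body_set L) = 0"
      and "\<forall>y\<in>body_set L. infdist y (body_set K) = 0"
      using le_iff[of K L 0] by (simp_all add: order_antisym infdist_nonneg)
    then have "body_set K = body_set L"
      by (metis body_set_compact body_set_nonempty compact_imp_closed in_closed_iff_infdist_zero
          subsetI subset_antisym)
    then show "K = L"
      by (simp add: body_set_inject)
  next
    assume "K = L"
    then show "dist K L = 0"
      by (simp add: dist_convex_body_def hausdorff_dist_def body_set_nonempty)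
  qed
  have inf_le: "infdist x (body_set B) \<le> dist A C + dist B C"
    if "x \<in> body_set A" for x and A B C :: "'a convex_body"
  proof -
    obtain z where z: "z \<in> body_set C" "infdist x (body_set C) = dist x z"
      using infdist_attains_inf[OF compact_imp_closed[OF body_set_compact] body_set_nonempty]
      by metis
    have "infdist x (body_set B) \<le> infdist z (body_set B) + dist x z"
      by (rule infdist_triangle)
    moreover have "infdist z (body_set B) \<le> dist B C"
      using le_iff[of B C "dist B C"] z by auto
    moreover have "dist x z \<le> dist A C"
      using le_iff[of A C "dist A C"] z that by auto
    ultimately show ?thesis by simp
  qed
  show "dist K L \<le> dist K M + dist L M"
    unfolding le_iff using inf_le[of _ K L M] inf_le[of _ L K M] by (auto simp: add.commute)
qed (simp_all add: uniformity_convex_body_def open_convex_body_def)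

end


section \<open>Valuations\<close>

text \<open>If the union of two convex bodies is convex, it is a body, and so is their intersection
  (which is nonempty because the union is connected). Hence \<^const>\<open>Body\<close> is
  applied to bodies only in the definition of valuations below.\<close>

lemma body_set_Body_Un_Int:
  fixes K L :: "'a::euclidean_space convex_body"
  assumes "convex (body_set K \<union> body_set L)"
  shows "body_set (Body (body_set K \<union> body_set L)) = body_set K \<union> body_set L"
    and "body_set (Body (body_set K \<inter> body_set L)) = body_set K \<inter> body_set L"
proof -
  have "connected (body_set K \<union> body_set L)"
    using assms by (rule convex_connected)
  then have "body_set K \<inter> body_set L \<noteq> {}"
    using connected_closedD[of "body_set K \<union> body_set L" "body_set K" "body_set L"]
      body_set_compact[of K] body_set_compact[of L] body_set_nonempty[of K]
      body_set_nonempty[of L] compact_imp_closed by blast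
  then show "body_set (Body (body_set K \<inter> body_set L)) = body_set K \<inter> body_set L"
    by (intro Body_inverse) (simp add: body_set_compact body_set_convex compact_Int convex_Int)
  show "body_set (Body (body_set K \<union> body_set L)) = body_set K \<union> body_set L"
    using assms by (intro Body_inverse) (simp add: body_set_compact body_set_nonempty compact_Un)
qed

definition valuation :: "('a::euclidean_space convex_body \<Rightarrow> real) \<Rightarrow> bool" where
  "valuation \<mu> \<longleftrightarrow> (\<forall>K L. convex (body_set K \<union> body_set L) \<longrightarrow>
     \<mu> K + \<mu> L = \<mu> (Body (body_set K \<union> body_set L)) + \<mu> (Body (body_set K \<inter> body_set L)))"

definition translation_invariant :: "('a::euclidean_space convex_body \<Rightarrow> real) \<Rightarrow> bool" where
  "translation_invariant \<mu> \<longleftrightarrow> (\<forall>a K. \<mu> (body_translate a K) = \<mu> K)"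

definition homogeneous :: "nat \<Rightarrow> ('a::euclidean_space convex_body \<Rightarrow> real) \<Rightarrow> bool" where
  "homogeneous k \<mu> \<longleftrightarrow> (\<forall>t\<ge>0. \<forall>K. \<mu> (t *\<^sub>R K) = t ^ k * \<mu> K)"

definition Val :: "nat \<Rightarrow> ('a::euclidean_space convex_body \<Rightarrow> real) set" where
  "Val k = {\<mu>. valuation \<mu> \<and> continuous_on UNIV \<mu> \<and> translation_invariant \<mu> \<and> homogeneous k \<mu>}"

lemma subspace_Val: "subspace (Val k)"
proof (rule subspaceI)
  show "0 \<in> Val k"
    by (simp add: Val_def valuation_def translation_invariant_def homogeneous_def zero_fun_def)
next
  fix \<mu> \<nu> :: "'a convex_body \<Rightarrow> real"
  assume "\<mu> \<in> Val k" and "\<nu> \<in> Val k"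
  then show "\<mu> + \<nu> \<in> Val k"
    by (auto simp: Val_def valuation_def translation_invariant_def homogeneous_def plus_fun_def
        distrib_left continuous_on_add add.assoc add.left_commute)
next
  fix c :: real and \<mu> :: "'a convex_body \<Rightarrow> real"
  assume "\<mu> \<in> Val k"
  then show "c *\<^sub>R \<mu> \<in> Val k"
    by (auto simp: Val_def valuation_def translation_invariant_def homogeneous_def scaleR_fun_def
        continuous_on_mult_left simp flip: distrib_left)
qed


section \<open>Mixed volumes\<close>

text \<open>The \<open>n\<close> arguments form a list of length \<open>n = DIM('a)\<close>, with indices running
  through \<open>{..<n}\<close> rather than \<open>{1..n}\<close>; the list \<open>is\<close> is the multi-index of the expansion.\<close>

definition is_mixed_volume :: "('a::euclidean_space convex_body list \<Rightarrow> real) \<Rightarrow> bool" where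
  "is_mixed_volume V \<longleftrightarrow>
     (\<forall>Ks Ls. length Ks = DIM('a) \<and> mset Ks = mset Ls \<longrightarrow> V Ks = V Ls) \<and>
     (\<forall>Ks (c :: nat \<Rightarrow> real). length Ks = DIM('a) \<and> (\<forall>i<DIM('a). c i \<ge> 0) \<longrightarrow>
        measure lebesgue (body_set (\<Sum>i<DIM('a). c i *\<^sub>R Ks ! i)) =
        (\<Sum>is\<in>{is. length is = DIM('a) \<and> set is \<subseteq> {..<DIM('a)}}.
           (\<Prod>j<DIM('a). c (is ! j)) * V (map ((!) Ks) is)))"

text \<open>The conditions determine \<open>V Ks\<close> whenever \<open>length Ks = DIM('a)\<close>: by symmetry the coefficient
  of \<open>c 0 * \<dots> * c (n - 1)\<close> is \<open>n!\<close> times \<open>V Ks\<close>. Lists of other lengths get no meaningful value.\<close>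

definition mixed_volume :: "'a::euclidean_space convex_body list \<Rightarrow> real" where
  "mixed_volume Ks = (THE v. \<exists>V. is_mixed_volume V \<and> v = V Ks)"

end

theory Submission
  imports Defs
begin

text \<open>
  Mixed volumes are multilinear, so \<open>K \<mapsto> V(K[k], L\<^sub>1, \<dots>)\<close> is Lipschitz for the Hausdorff metric on
  every bounded set of bodies, and so is every finite linear combination. A limit of such
  combinations that is uniform on bounded sets is still in \<open>Val k\<close>, but it can lose this property,
  and this is how the two spaces are separated.

  For the separating valuation, let \<open>p, q\<close> be two coordinate directions with unit vectors \<open>e\<^sub>p, e\<^sub>q\<close>,
  split the remaining \<open>n - 2\<close> directions into \<open>k - 1\<close> and \<open>n - k - 1\<close>, let \<open>D\<close> be the list of unit
  segments in the latter and put \<open>w(d) = e\<^sub>p + d e\<^sub>q\<close>. With \<open>\<delta>\<^sub>i = 4\<^sup>-\<^sup>i\<close> consider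
  \<open>\<phi>(K) = (\<Sum>i. 2\<^sup>i (V(K[k], [0, w(0)], D) - V(K[k], [0, w(\<delta>\<^sub>i)], D)))\<close>.
  The two segments have distance at most \<open>\<delta>\<^sub>i\<close>, so the \<open>i\<close>-th term is \<open>O(2\<^sup>-\<^sup>i)\<close> on bounded sets and the
  series defines an element of \<open>Val k\<close> (\<open>suminf_in_Val\<close>). Let \<open>A\<^sub>t\<close> be the sum of \<open>[0, w(t)]\<close> and the unit
  segments in the \<open>k - 1\<close> directions. The mixed volume \<open>V(A\<^sub>t[k], [0, w(d)], D)\<close> is a positive constant
  times \<open>\<bar>t - d\<bar>\<close>, because \<open>w(t)\<close> and \<open>w(d)\<close> span a parallelogram of that area
  (\<open>polarized_vol_slanted_box\<close>). Moving \<open>t\<close> from \<open>0\<close> to \<open>\<delta>\<^sub>j\<close> moves \<open>A\<^sub>t\<close> by at most \<open>\<delta>\<^sub>j\<close>; no term of the series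
  decreases, and the \<open>j\<close>-th one grows by a constant times \<open>2\<^sup>j \<delta>\<^sub>j\<close>. Hence \<open>\<phi>\<close> is not Lipschitz near \<open>A\<^sub>0\<close>.

  The mixed volume itself is obtained by polarization: \<open>n! V(K\<^sub>1, \<dots>, K\<^sub>n)\<close> is the \<open>n\<close>-fold iterated
  difference of the volume at \<open>{0}\<close> in the directions \<open>K\<^sub>1, \<dots>, K\<^sub>n\<close>. Everything that is needed of it
  (multilinearity, expansion of the volume of a Minkowski sum) rests on one fact: all
  \<open>(n + 1)\<close>-fold differences of the volume vanish (\<open>idiff_body_vol_eq_0\<close>). This is proved with an idea
  of Gromov. If \<open>u\<close> is a smooth convex function on \<open>\<real>\<^sup>n\<close> at bounded distance from the support function of
  \<open>K\<close>, then its gradient maps \<open>\<real>\<^sup>n\<close> onto \<open>K\<close> up to the boundary, so \<open>vol(K) = \<integral> det(\<nabla>\<^sup>2 u)\<close>. Such functions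
  can be added along with the bodies, hence differences of the volume are integrals of differences
  of the determinant, and the determinant is a polynomial of degree \<open>n\<close>.
\<close>

section \<open>Iterated differences\<close>

text \<open>The argument of the functions is only a commutative monoid, so that the same operator applies to
  matrices, to real numbers and to convex bodies under Minkowski addition.\<close>

fun idiff :: "('b::comm_monoid_add \<Rightarrow> real) \<Rightarrow> 'b list \<Rightarrow> 'b \<Rightarrow> real" where
  "idiff f [] x = f x"
| "idiff f (h # hs) x = idiff f hs (x + h) - idiff f hs x"

lemma idiff_move_front: "idiff f (as @ h # bs) x = idiff f (h # as @ bs) x"
  by (induction as arbitrary: x) (simp_all add: ac_simps)

lemma idiff_mset:
  assumes "mset hs = mset hs'"
  shows "idiff f hs x = idiff f hs' x"
  using assms
proof (induction hs arbitrary: hs' x)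
  case (Cons h hs)
  then have "h \<in> set hs'"
    by (metis list.set_intros(1) set_mset_mset)
  then obtain as bs where hs': "hs' = as @ h # bs"
    by (meson split_list)
  with Cons.prems have "mset hs = mset (as @ bs)"
    by simp
  then have "idiff f hs y = idiff f (as @ bs) y" for y
    by (rule Cons.IH)
  then show ?case
    unfolding hs' idiff_move_front by simp
qed simp

lemma idiff_shift: "idiff (\<lambda>x. f (x + h)) hs x = idiff f hs (x + h)"
  by (induction hs arbitrary: x) (simp_all add: ac_simps)

lemma idiff_add: "idiff (\<lambda>x. f x + g x) hs x = idiff f hs x + idiff g hs x"
  by (induction hs arbitrary: x) simp_all

lemma idiff_diff: "idiff (\<lambda>x. f x - g x) hs x = idiff f hs x - idiff g hs x"
  by (induction hs arbitrary: x) simp_all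

lemma idiff_cmult: "idiff (\<lambda>x. c * f x) hs x = c * idiff f hs x"
  by (induction hs arbitrary: x) (simp_all add: algebra_simps)

lemma idiff_zero: "idiff (\<lambda>x. 0) hs x = 0"
  by (induction hs arbitrary: x) simp_all

lemma idiff_sum: "idiff (\<lambda>x. \<Sum>i\<in>I. f i x) hs x = (\<Sum>i\<in>I. idiff (f i) hs x)"
  by (induction I rule: infinite_finite_induct) (simp_all add: idiff_zero idiff_add)

lemma idiff_Cons_difference: "idiff f (h # hs) x = idiff (\<lambda>x. f (x + h) - f x) hs x"
  by (simp add: idiff_diff idiff_shift)

text \<open>Vanishing of all \<open>m\<close>-fold differences expresses that a function is a polynomial of degree less
  than \<open>m\<close>, without reference to any notion of polynomial on the monoid.\<close>

definition idiff_vanish :: "nat \<Rightarrow> ('b::comm_monoid_add \<Rightarrow> real) \<Rightarrow> bool" where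
  "idiff_vanish m f \<longleftrightarrow> (\<forall>hs x. length hs = m \<longrightarrow> idiff f hs x = 0)"

text \<open>Product rule: the difference of \<open>f l\<close> in direction \<open>h\<close> is \<open>(\<Delta>\<^sub>h f) l\<close> plus a constant times a shift
  of \<open>f\<close>, and both have lower degree than \<open>f l\<close>.\<close>

lemma idiff_vanish_mult_additive:
  assumes "\<And>x y. l (x + y) = l x + l y" and "idiff_vanish m f"
  shows "idiff_vanish (Suc m) (\<lambda>x. f x * l x)"
  using assms(2)
proof (induction m arbitrary: f)
  case 0
  then have "f = (\<lambda>x. 0)"
    by (simp add: idiff_vanish_def fun_eq_iff)
  then show ?case
    by (simp add: idiff_vanish_def idiff_zero)
next
  case (Suc m)
  show ?case
    unfolding idiff_vanish_def
  proof (intro allI impI)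
    fix hs :: "'a list" and x
    assume len: "length hs = Suc (Suc m)"
    then obtain h hs' where hs: "hs = h # hs'" "length hs' = Suc m"
      by (cases hs) auto
    have "idiff_vanish m (\<lambda>x. f (x + h) - f x)"
      unfolding idiff_vanish_def
    proof (intro allI impI)
      fix gs :: "'a list" and y
      assume "length gs = m"
      then have "idiff f (h # gs) y = 0"
        using Suc.prems unfolding idiff_vanish_def by (metis length_Cons)
      then show "idiff (\<lambda>x. f (x + h) - f x) gs y = 0"
        by (simp only: idiff_Cons_difference)
    qed
    then have "idiff_vanish (Suc m) (\<lambda>x. (f (x + h) - f x) * l x)"
      by (rule Suc.IH)
    moreover have "f (x + h) * l (x + h) - f x * l x = (f (x + h) - f x) * l x + l h * f (x + h)" for x
      by (simp add: assms(1) algebra_simps)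
    moreover have "idiff f hs' y = 0" for y
      using Suc.prems hs(2) by (auto simp: idiff_vanish_def)
    ultimately show "idiff (\<lambda>x. f x * l x) hs x = 0"
      using hs(2) by (simp add: hs(1) idiff_Cons_difference idiff_add idiff_cmult idiff_shift
          idiff_vanish_def del: idiff.simps)
  qed
qed

lemma idiff_vanish_prod_additive:
  assumes "finite S" and "\<And>i x y. i \<in> S \<Longrightarrow> l i (x + y) = l i x + l i y"
  shows "idiff_vanish (Suc (card S)) (\<lambda>x. \<Prod>i\<in>S. l i x)"
  using assms
proof (induction S rule: finite_induct)
  case empty
  show ?case
    by (auto simp: idiff_vanish_def length_Suc_conv)
next
  case (insert i S)
  then have "idiff_vanish (Suc (Suc (card S))) (\<lambda>x. (\<Prod>j\<in>S. l j x) * l i x)"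
    by (intro idiff_vanish_mult_additive) auto
  with insert show ?case
    by (simp add: mult.commute)
qed

text \<open>By the Leibniz formula the determinant is a sum of products of \<open>n\<close> matrix entries, each of which
  is additive.\<close>

lemma idiff_vanish_det: "idiff_vanish (Suc CARD('n)) (det :: real^'n^'n \<Rightarrow> real)"
proof -
  have "idiff (\<lambda>A::real^'n^'n. \<Prod>i\<in>UNIV. A $ i $ p i) hs x = 0"
    if "length hs = Suc CARD('n)" for p hs x
    using idiff_vanish_prod_additive[of "UNIV :: 'n set" "\<lambda>i A. A $ i $ p i"] that
    by (simp add: idiff_vanish_def)
  then show ?thesis
    unfolding idiff_vanish_def det_def[abs_def] idiff_sum idiff_cmult by simp
qed

text \<open>The Leibniz rule for the \<open>m\<close>-fold difference of a product with the identity; inductively it computes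
  the leading differences of the powers.\<close>

lemma idiff_mult_ident:
  fixes x :: real
  shows "idiff (\<lambda>t. f t * t) (replicate m 1) x =
    x * idiff f (replicate m 1) x + real m * idiff f (replicate (m - 1) 1) (x + 1)"
proof (induction m arbitrary: x)
  case (Suc m)
  show ?case
  proof (cases m)
    case 0
    then show ?thesis by (simp add: algebra_simps)
  next
    case (Suc k)
    let ?F = "\<lambda>y. idiff f (replicate m 1) y" and ?E = "\<lambda>y. idiff f (replicate k 1) y"
    have F: "?F y = ?E (y + 1) - ?E y" for y
      by (simp add: Suc)
    have "idiff (\<lambda>t. f t * t) (replicate (Suc m) 1) x =
        (x + 1) * ?F (x + 1) + real m * ?E (x + 1 + 1) - (x * ?F x + real m * ?E (x + 1))"
      by (simp only: replicate_Suc idiff.simps Suc.IH) (simp add: Suc)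
    also have "\<dots> = x * (?F (x + 1) - ?F x) + real (Suc m) * ?F (x + 1)"
      unfolding F by (simp add: algebra_simps)
    finally show ?thesis
      by simp
  qed
qed simp

lemma idiff_power:
  fixes x :: real
  shows "idiff (\<lambda>t. t ^ m) (replicate m 1) x = fact m"
proof (induction m arbitrary: x)
  case (Suc m)
  have "idiff (\<lambda>t. t ^ m) (replicate (Suc m) 1) x = (0::real)"
    using idiff_vanish_prod_additive[of "{..<m}" "\<lambda>_ x. x :: real"]
    by (simp add: idiff_vanish_def del: replicate.simps)
  then have "idiff (\<lambda>t. t ^ m * t) (replicate (Suc m) 1) x = fact (Suc m)"
    unfolding idiff_mult_ident using Suc by simp
  then show ?case
    by (simp only: power_Suc2)
qed simp

section \<open>Gradient maps onto convex bodies\<close>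

text \<open>The map \<open>G\<close> is the gradient of a convex function \<open>u\<close> whose distance from the support function of
  \<open>K\<close> is bounded. Convexity and the gradient property are both encoded in the tangent inequality, and
  the third clause says \<open>\<bar>u - h\<^sub>K\<bar> \<le> c\<close> without naming the support function \<open>h\<^sub>K\<close>.\<close>

definition gradient_represents ::
  "'a::euclidean_space set \<Rightarrow> ('a \<Rightarrow> real) \<Rightarrow> ('a \<Rightarrow> 'a) \<Rightarrow> bool" where
  "gradient_represents K u G \<longleftrightarrow>
     (\<forall>x. G differentiable (at x)) \<and>
     (\<forall>x y. u x + G x \<bullet> (y - x) \<le> u y) \<and>
     (\<exists>c. \<forall>y. (\<forall>x\<in>K. x \<bullet> y \<le> u y + c) \<and> (\<exists>x\<in>K. u y \<le> x \<bullet> y + c))"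

lemma gradient_represents_add:
  assumes K: "gradient_represents K u G" and L: "gradient_represents L v H"
  shows "gradient_represents {x + y | x y. x \<in> K \<and> y \<in> L} (\<lambda>x. u x + v x) (\<lambda>x. G x + H x)"
proof -
  obtain c where c: "\<And>y x. x \<in> K \<Longrightarrow> x \<bullet> y \<le> u y + c" "\<And>y. \<exists>x\<in>K. u y \<le> x \<bullet> y + c"
    using K unfolding gradient_represents_def by metis
  obtain d where d: "\<And>y x. x \<in> L \<Longrightarrow> x \<bullet> y \<le> v y + d" "\<And>y. \<exists>x\<in>L. v y \<le> x \<bullet> y + d"
    using L unfolding gradient_represents_def by metis
  have "\<exists>c. \<forall>y. (\<forall>x\<in>{x + y | x y. x \<in> K \<and> y \<in> L}. x \<bullet> y \<le> u y + v y + c) \<and>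
      (\<exists>x\<in>{x + y | x y. x \<in> K \<and> y \<in> L}. u y + v y \<le> x \<bullet> y + c)"
  proof (intro exI[of _ "c + d"] allI conjI ballI)
    fix y z assume "z \<in> {x + y | x y. x \<in> K \<and> y \<in> L}"
    then obtain a b where "z = a + b" "a \<in> K" "b \<in> L" by auto
    then show "z \<bullet> y \<le> u y + v y + (c + d)"
      using c(1)[of a y] d(1)[of b y] by (simp add: inner_add_left)
  next
    fix y
    obtain a b where "a \<in> K" "b \<in> L" "u y \<le> a \<bullet> y + c" "v y \<le> b \<bullet> y + d"
      using c(2)[of y] d(2)[of y] by auto
    then show "\<exists>x\<in>{x + y | x y. x \<in> K \<and> y \<in> L}. u y + v y \<le> x \<bullet> y + (c + d)"
      by (intro bexI[of _ "a + b"]) (auto simp: inner_add_left)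
  qed
  moreover have "u x + v x + (G x + H x) \<bullet> (y - x) \<le> u y + v y" for x y
  proof -
    have "u x + G x \<bullet> (y - x) \<le> u y" "v x + H x \<bullet> (y - x) \<le> v y"
      using K L unfolding gradient_represents_def by blast+
    then show ?thesis by (simp add: inner_add_left)
  qed
  moreover have "(\<lambda>x. G x + H x) differentiable (at x)" for x
    using K L unfolding gradient_represents_def by (blast intro: differentiable_add)
  ultimately show ?thesis
    unfolding gradient_represents_def by blast
qed

text \<open>If \<open>G x\<close> were outside \<open>K\<close>, some direction \<open>a\<close> would separate it from \<open>K\<close>. Along the ray \<open>x - s a\<close>
  the tangent at \<open>x\<close> then grows faster than the support function, and \<open>u\<close> with it, which contradicts
  the bounded distance.\<close>

lemma gradient_represents_range:
  assumes rep: "gradient_represents K u G" and K: "compact K" "convex K"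
  shows "G x \<in> K"
proof (rule ccontr)
  assume "G x \<notin> K"
  then obtain a b where ab: "a \<bullet> G x < b" "\<And>z. z \<in> K \<Longrightarrow> b < a \<bullet> z"
    using separating_hyperplane_closed_point[OF \<open>convex K\<close> compact_imp_closed] K by blast
  obtain c where c: "\<And>y. \<exists>z\<in>K. u y \<le> z \<bullet> y + c"
    using rep unfolding gradient_represents_def by metis
  obtain R where R: "\<And>z. z \<in> K \<Longrightarrow> norm z \<le> R"
    using K(1) compact_imp_bounded bounded_iff by metis
  \<comment> \<open>the tangent at x evaluated at x - s a, compared with the support function there\<close>
  have bound: "s * (b - a \<bullet> G x) \<le> R * norm x + c - u x" if "s \<ge> 0" for s
  proof -
    obtain z where z: "z \<in> K" "u (x - s *\<^sub>R a) \<le> z \<bullet> (x - s *\<^sub>R a) + c"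
      using c by blast
    have "u x + G x \<bullet> ((x - s *\<^sub>R a) - x) \<le> u (x - s *\<^sub>R a)"
      using rep unfolding gradient_represents_def by blast
    then have "u x - s * (a \<bullet> G x) \<le> u (x - s *\<^sub>R a)"
      by (simp add: inner_commute)
    also have "\<dots> \<le> z \<bullet> x - s * (a \<bullet> z) + c"
      using z(2) by (simp add: inner_diff_right inner_commute)
    also have "\<dots> \<le> R * norm x - s * b + c"
    proof -
      have "z \<bullet> x \<le> R * norm x"
        using norm_cauchy_schwarz[of z x] R[OF z(1)] by (meson mult_right_mono norm_ge_zero order_trans)
      moreover have "s * b \<le> s * (a \<bullet> z)"
        using ab(2)[OF z(1)] that by (simp add: mult_left_mono)
      ultimately show ?thesis by linarith
    qed
    finally show ?thesis by (simp add: algebra_simps)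
  qed
  define M where "M = R * norm x + c - u x"
  have d: "b - a \<bullet> G x > 0"
    using ab(1) by simp
  have "0 \<le> M"
    using bound[of 0] by (simp add: M_def)
  then have "(M + 1) / (b - a \<bullet> G x) * (b - a \<bullet> G x) \<le> M"
    unfolding M_def by (intro bound) (use d in \<open>simp add: M_def\<close>)
  with d show False
    by simp
qed

text \<open>For \<open>p\<close> in the interior, \<open>u x - p \<bullet> x\<close> grows at least like \<open>r \<bar>x\<bar>\<close>, where \<open>r\<close> is the radius of a
  ball about \<open>p\<close> in \<open>K\<close>. It therefore has a minimizer, and the gradient there is \<open>p\<close>.\<close>

lemma gradient_represents_surj:
  assumes rep: "gradient_represents K u G" and K: "compact K" "convex K" and p: "p \<in> interior K"
  shows "\<exists>x. G x = p"
proof -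
  have tangent: "u x + G x \<bullet> (y - x) \<le> u y" for x y
    using rep unfolding gradient_represents_def by blast
  obtain c where c: "\<And>y x. x \<in> K \<Longrightarrow> x \<bullet> y \<le> u y + c"
    using rep unfolding gradient_represents_def by metis
  obtain r where r: "r > 0" "cball p r \<subseteq> K"
    using p mem_interior_cball by blast
  obtain R where R: "\<And>z. z \<in> K \<Longrightarrow> norm z \<le> R"
    using K(1) compact_imp_bounded bounded_iff by metis
  have "R-lipschitz_on UNIV u"
  proof (rule lipschitz_onI)
    have *: "u y - u x \<le> R * norm (y - x)" for x y
    proof -
      have "u y - u x \<le> G y \<bullet> (y - x)"
        using tangent[of y x] by (simp add: inner_diff_right)
      also have "\<dots> \<le> norm (G y) * norm (y - x)"
        by (rule norm_cauchy_schwarz)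
      also have "\<dots> \<le> R * norm (y - x)"
        by (intro mult_right_mono R gradient_represents_range[OF rep K]) simp
      finally show ?thesis .
    qed
    show "dist (u x) (u y) \<le> R * dist x y" for x y
      using *[of x y] *[of y x] by (simp add: dist_real_def dist_norm norm_minus_commute abs_le_iff)
    show "0 \<le> R"
      using R[OF gradient_represents_range[OF rep K]] norm_ge_zero order_trans by blast
  qed
  then have cont: "continuous_on A (\<lambda>x. u x - p \<bullet> x)" for A
    by (intro continuous_intros) (meson continuous_on_subset lipschitz_on_continuous_on subset_UNIV)
  have coercive: "r * norm x \<le> u x - p \<bullet> x + c" for x
  proof (cases "x = 0")
    case True
    then show ?thesis
      using c[of p 0] subsetD[OF r(2), of p] r(1) by simp
  next
    case False
    \<comment> \<open>the point of the ball about p that is farthest in the direction of x\<close>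
    have "p + (r / norm x) *\<^sub>R x \<in> K"
      using r False by (intro subsetD[OF r(2)]) (simp add: dist_norm)
    then have "(p + (r / norm x) *\<^sub>R x) \<bullet> x \<le> u x + c"
      by (rule c)
    moreover have "((r / norm x) *\<^sub>R x) \<bullet> x = r * norm x"
      using False by (simp add: dot_square_norm power2_eq_square)
    ultimately show ?thesis
      by (simp add: inner_add_left)
  qed
  define B where "B = max 0 ((u 0 + c) / r)"
  obtain x0 where x0: "x0 \<in> cball 0 B" "\<And>x. x \<in> cball 0 B \<Longrightarrow> u x0 - p \<bullet> x0 \<le> u x - p \<bullet> x"
    using continuous_attains_inf[OF compact_cball _ cont, of 0 B] by (auto simp: B_def)
  have min: "u x0 - p \<bullet> x0 \<le> u x - p \<bullet> x" for x
  proof (cases "x \<in> cball 0 B")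
    case False
    then have "(u 0 + c) / r < norm x"
      by (simp add: B_def)
    then have "u 0 + c < r * norm x"
      using r(1) by (simp add: field_simps)
    then have "u 0 < u x - p \<bullet> x"
      using coercive[of x] by simp
    moreover have "u x0 - p \<bullet> x0 \<le> u 0"
      using x0(2)[of 0] by (simp add: B_def)
    ultimately show ?thesis by simp
  qed (rule x0)
  have "0 \<le> (G x0 - p) \<bullet> h" for h
  proof (rule tendsto_lowerbound)
    have "isCont G x0"
      using rep unfolding gradient_represents_def by (blast intro: differentiable_imp_continuous_within)
    then have "((\<lambda>s. G (x0 + s *\<^sub>R h)) \<longlongrightarrow> G x0) (at_right 0)"
      by (rule isCont_tendsto_compose) (auto intro!: tendsto_eq_intros)
    then show "((\<lambda>s. (G (x0 + s *\<^sub>R h) - p) \<bullet> h) \<longlongrightarrow> (G x0 - p) \<bullet> h) (at_right 0)"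
      by (intro tendsto_intros)
    have "0 \<le> (G (x0 + s *\<^sub>R h) - p) \<bullet> h" if "s > 0" for s
    proof -
      have "s * ((G (x0 + s *\<^sub>R h) - p) \<bullet> h) \<ge> 0"
        using min[of "x0 + s *\<^sub>R h"] tangent[of "x0 + s *\<^sub>R h" x0]
        by (simp add: inner_diff_left inner_diff_right inner_add_right algebra_simps)
      then show ?thesis
        using that by (simp add: zero_le_mult_iff)
    qed
    then show "\<forall>\<^sub>F s in at_right 0. 0 \<le> (G (x0 + s *\<^sub>R h) - p) \<bullet> h"
      by (simp add: eventually_at_filter)
  qed simp
  from this[of "- (G x0 - p)"] have "(G x0 - p) \<bullet> (G x0 - p) \<le> 0"
    unfolding inner_minus_right by simp
  then have "G x0 - p = 0"
    using inner_gt_zero_iff[of "G x0 - p"] by linarith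
  then show ?thesis
    by (intro exI[of _ x0]) simp
qed

text \<open>Along the segment from the identity to \<open>A\<close> the determinant starts at \<open>1\<close>, and it cannot vanish
  before the end since all matrices met earlier are positive definite.\<close>

lemma det_nonneg_if_monotone:
  fixes A :: "real^'n^'n"
  assumes "\<And>h. 0 \<le> (A *v h) \<bullet> h"
  shows "0 \<le> det A"
proof (rule ccontr)
  assume neg: "\<not> 0 \<le> det A"
  define F where "F s = (1 - s) *\<^sub>R A + s *\<^sub>R mat 1" for s :: real
  have "continuous_on {0..1} (\<lambda>s. det (F s))"
    unfolding det_def F_def by (intro continuous_intros)
  moreover have "det (F 0) \<le> 0" "0 \<le> det (F 1)"
    using neg by (simp_all add: F_def)
  ultimately obtain s where s: "0 \<le> s" "s \<le> 1" "det (F s) = 0"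
    using IVT'[of "\<lambda>s. det (F s)" 0 0 1] by auto
  then have "s \<noteq> 0"
    using neg by (auto simp: F_def)
  obtain h where h: "h \<noteq> 0" "F s *v h = 0"
    using s(3) by (metis invertible_det_nz matrix_left_invertible_ker invertible_left_inverse)
  have "(F s *v h) \<bullet> h = (1 - s) * ((A *v h) \<bullet> h) + s * (h \<bullet> h)"
    by (simp add: F_def matrix_vector_mult_add_rdistrib scaleR_matrix_vector_assoc[symmetric] inner_add_left)
  moreover have "s * (h \<bullet> h) > 0"
    using s \<open>s \<noteq> 0\<close> h(1) by simp
  moreover have "(1 - s) * ((A *v h) \<bullet> h) \<ge> 0"
    using s assms by simp
  ultimately show False
    using h(2) by simp
qed

definition jacobian :: "(real^'n \<Rightarrow> real^'n) \<Rightarrow> real^'n \<Rightarrow> real^'n^'n" where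
  "jacobian G x = matrix (frechet_derivative G (at x))"

lemma jacobian_works:
  assumes "G differentiable (at x)"
  shows "(G has_derivative (\<lambda>h. jacobian G x *v h)) (at x)"
proof -
  have der: "(G has_derivative frechet_derivative G (at x)) (at x)"
    using assms frechet_derivative_works by blast
  then have "frechet_derivative G (at x) = (\<lambda>h. jacobian G x *v h)"
    unfolding jacobian_def
    using has_derivative_linear[OF der] by simp
  with der show ?thesis
    by simp
qed

lemma jacobian_unique:
  assumes "(G has_derivative (\<lambda>h. A *v h)) (at x)"
  shows "jacobian G x = A"
  using frechet_derivative_at[OF assms] matrix_of_matrix_vector_mul[of A]
  unfolding jacobian_def by simp

lemma jacobian_add:
  assumes "G differentiable (at x)" "H differentiable (at x)"
  shows "jacobian (\<lambda>x. G x + H x) x = jacobian G x + jacobian H x"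
  using has_derivative_add[OF jacobian_works[OF assms(1)] jacobian_works[OF assms(2)]]
  by (intro jacobian_unique) (simp add: matrix_vector_mult_add_rdistrib)

text \<open>Adding the tangent inequalities at two points shows that \<open>G\<close> is monotone, and so is its derivative.\<close>

lemma det_jacobian_nonneg:
  assumes "gradient_represents K u G"
  shows "0 \<le> det (jacobian G x)"
proof (rule det_nonneg_if_monotone)
  fix h
  have tangent: "u x + G x \<bullet> (y - x) \<le> u y" for x y
    using assms unfolding gradient_represents_def by blast
  have "(G has_derivative (\<lambda>h. jacobian G x *v h)) (at x)"
    using assms unfolding gradient_represents_def by (blast intro: jacobian_works)
  moreover have "((\<lambda>s. x + s *\<^sub>R h) has_derivative (\<lambda>s. s *\<^sub>R h)) (at 0)"
    by (auto intro!: derivative_eq_intros)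
  ultimately have "((\<lambda>s. G (x + s *\<^sub>R h)) has_derivative (\<lambda>s. jacobian G x *v (s *\<^sub>R h))) (at 0)"
    using has_derivative_compose[of "\<lambda>s. x + s *\<^sub>R h" "\<lambda>s. s *\<^sub>R h" 0 UNIV G
        "\<lambda>h. jacobian G x *v h"] by simp
  then have "((\<lambda>s. G (x + s *\<^sub>R h)) has_vector_derivative (jacobian G x *v h)) (at 0)"
    by (simp add: has_vector_derivative_def matrix_vector_mult_scaleR)
  then have "((\<lambda>s. (G (x + s *\<^sub>R h) \<bullet> h)) has_real_derivative (jacobian G x *v h) \<bullet> h) (at 0)"
    unfolding has_real_derivative_iff_has_vector_derivative
    by (rule bounded_linear.has_vector_derivative[OF bounded_linear_inner_left])
  then have lim: "((\<lambda>s. (G (x + s *\<^sub>R h) \<bullet> h - G x \<bullet> h) / s) \<longlongrightarrow> (jacobian G x *v h) \<bullet> h) (at 0)"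
    by (simp add: DERIV_def)
  have "0 \<le> (G (x + s *\<^sub>R h) \<bullet> h - G x \<bullet> h) / s" for s
  proof -
    have "0 \<le> s * (G (x + s *\<^sub>R h) \<bullet> h - G x \<bullet> h)"
      using tangent[of x "x + s *\<^sub>R h"] tangent[of "x + s *\<^sub>R h" x] by (simp add: algebra_simps)
    then show ?thesis
      by (auto simp: zero_le_divide_iff zero_le_mult_iff)
  qed
  then show "0 \<le> (jacobian G x *v h) \<bullet> h"
    by (intro tendsto_lowerbound[OF lim]) auto
qed

text \<open>The range of \<open>G\<close> lies between \<open>K\<close> and its interior, and the boundary of a convex set is a null set;
  the rest is the change of variables formula.\<close>

lemma measure_gradient_represents:
  fixes K :: "(real^'m::{finite,wellorder}) set"
  assumes rep: "gradient_represents K u G" and K: "compact K" "convex K" and "inj G"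
  shows "((\<lambda>x. det (jacobian G x)) has_integral measure lebesgue K) UNIV"
proof -
  have der: "(G has_derivative (\<lambda>h. jacobian G x *v h)) (at x within UNIV)" for x
    using rep unfolding gradient_represents_def by (blast intro: jacobian_works)
  have "interior K \<subseteq> range G" "range G \<subseteq> K"
    using gradient_represents_surj[OF rep K] gradient_represents_range[OF rep K] by blast+
  moreover have "negligible (frontier K)" "closed K"
    using K by (auto intro: negligible_convex_frontier compact_imp_closed)
  ultimately have neg: "negligible ((K - range G) \<union> (range G - K))"
    by (elim negligible_subset) (auto simp: frontier_def)
  have "K \<in> lmeasurable"
    using K(1) by (rule lmeasurable_compact)
  note meas = lmeasurable_negligible_symdiff[OF this neg] measure_negligible_symdiff[OF this neg]
  have abs: "\<bar>det (matrix (\<lambda>h. jacobian G x *v h))\<bar> = det (jacobian G x)" for x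
    using det_jacobian_nonneg[OF rep, of x] by simp
  have int: "(\<lambda>x. det (jacobian G x)) integrable_on UNIV"
    using measurable_differentiable_image_eq[OF _ der \<open>inj G\<close>] meas(1) unfolding abs by simp
  then have "measure lebesgue (range G) = integral UNIV (\<lambda>x. det (jacobian G x))"
    using measure_differentiable_image_eq[OF _ der \<open>inj G\<close>] unfolding abs by simp
  with int meas(2) show ?thesis
    by (simp add: has_integral_iff)
qed

section \<open>Smooth convex functions close to support functions\<close>

text \<open>The function \<open>u y = ln (\<Sum>v\<in>S. exp (v \<bullet> y))\<close> exceeds the support function \<open>max\<^sub>v (v \<bullet> y)\<close> by at most
  \<open>ln (card S)\<close>. The tangent inequality is Jensen's inequality for the exponential function, with the
  probability weights \<open>exp (v \<bullet> x) / Z x\<close>.\<close>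

lemma gradient_represents_convex_hull:
  fixes S :: "'a::euclidean_space set"
  assumes "finite S" "S \<noteq> {}"
  shows "\<exists>u G. gradient_represents (convex hull S) u G"
proof -
  define Z where "Z y = (\<Sum>v\<in>S. exp (v \<bullet> y))" for y :: 'a
  define G where "G y = inverse (Z y) *\<^sub>R (\<Sum>v\<in>S. exp (v \<bullet> y) *\<^sub>R v)" for y :: 'a
  have Z: "Z y > 0" for y
    unfolding Z_def using assms by (intro sum_pos) auto
  have "G differentiable (at x)" for x
  proof -
    have "(Z has_derivative (\<lambda>h. \<Sum>v\<in>S. exp (v \<bullet> x) * (v \<bullet> h))) (at x)"
      unfolding Z_def[abs_def] by (auto intro!: derivative_eq_intros simp: mult.commute)
    moreover have "((\<lambda>y. \<Sum>v\<in>S. exp (v \<bullet> y) *\<^sub>R v) has_derivative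
        (\<lambda>h. \<Sum>v\<in>S. (exp (v \<bullet> x) * (v \<bullet> h)) *\<^sub>R v)) (at x)"
      by (auto intro!: derivative_eq_intros simp: mult.commute)
    ultimately show ?thesis
      unfolding G_def[abs_def] using Z[of x]
      by (intro differentiable_scaleR differentiable_inverse) (auto simp: differentiable_def)
  qed
  moreover have "ln (Z x) + G x \<bullet> (y - x) \<le> ln (Z y)" for x y
  proof -
    define m where "m = G x \<bullet> (y - x)"
    have m: "(\<Sum>v\<in>S. exp (v \<bullet> x) * (v \<bullet> (y - x))) = Z x * m"
      using Z[of x] unfolding m_def G_def inner_scaleR_left inner_sum_left
      by (simp add: mult.assoc[symmetric] less_imp_neq[symmetric])
    have "exp (v \<bullet> x) * (exp m * (1 + (v \<bullet> (y - x) - m))) \<le> exp (v \<bullet> y)" for v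
    proof -
      \<comment> \<open>the tangent of exp at the mean exponent m; the linear terms cancel in the sum over v\<close>
      have "exp m * (1 + (v \<bullet> (y - x) - m)) \<le> exp m * exp (v \<bullet> (y - x) - m)"
        by (intro mult_left_mono exp_ge_add_one_self) simp
      also have "\<dots> = exp (v \<bullet> (y - x))"
        by (simp add: mult_exp_exp)
      finally have "exp (v \<bullet> x) * (exp m * (1 + (v \<bullet> (y - x) - m)))
          \<le> exp (v \<bullet> x) * exp (v \<bullet> (y - x))"
        by (intro mult_left_mono) auto
      then show ?thesis
        by (simp add: mult_exp_exp inner_diff_right)
    qed
    then have "(\<Sum>v\<in>S. exp (v \<bullet> x) * (exp m * (1 + (v \<bullet> (y - x) - m)))) \<le> Z y"
      unfolding Z_def by (rule sum_mono)
    also have "(\<Sum>v\<in>S. exp (v \<bullet> x) * (exp m * (1 + (v \<bullet> (y - x) - m)))) =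
        exp m * ((1 - m) * Z x + (\<Sum>v\<in>S. exp (v \<bullet> x) * (v \<bullet> (y - x))))"
      by (simp add: Z_def sum_distrib_left sum.distrib[symmetric] algebra_simps)
    also have "\<dots> = exp m * Z x"
      unfolding m by (simp add: algebra_simps)
    finally have "ln (exp m * Z x) \<le> ln (Z y)"
      using Z[of x] Z[of y] by (subst ln_le_cancel_iff) auto
    then show ?thesis
      using Z[of x] by (simp add: ln_mult m_def)
  qed
  moreover have "\<exists>c. \<forall>y. (\<forall>x\<in>convex hull S. x \<bullet> y \<le> ln (Z y) + c) \<and>
      (\<exists>x\<in>convex hull S. ln (Z y) \<le> x \<bullet> y + c)"
  proof (intro exI[of _ "ln (real (card S))"] allI conjI ballI)
    have card: "card S > 0"
      using assms by (simp add: card_gt_0_iff)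
    fix y
    have "v \<bullet> y \<le> ln (Z y)" if "v \<in> S" for v
    proof -
      have "exp (v \<bullet> y) \<le> Z y"
        unfolding Z_def using assms that by (intro member_le_sum) auto
      then show ?thesis
        using Z[of y] by (simp add: ln_ge_iff)
    qed
    moreover have "convex {x. x \<bullet> y \<le> ln (Z y)}"
      using convex_halfspace_le[of y "ln (Z y)"] by (simp add: inner_commute)
    ultimately have "convex hull S \<subseteq> {x. x \<bullet> y \<le> ln (Z y)}"
      by (intro hull_minimal) auto
    then show "x \<bullet> y \<le> ln (Z y) + ln (real (card S))" if "x \<in> convex hull S" for x
      using that card by (auto intro: add_increasing2)
    obtain v where v: "v \<in> S" "\<And>w. w \<in> S \<Longrightarrow> w \<bullet> y \<le> v \<bullet> y"
      using Max_in[of "(\<lambda>v. v \<bullet> y) ` S"] Max_ge[of "(\<lambda>v. v \<bullet> y) ` S"] assms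
      by (metis (no_types, lifting) finite_imageI image_eqI image_iff image_is_empty)
    then have "Z y \<le> real (card S) * exp (v \<bullet> y)"
      unfolding Z_def by (intro sum_bounded_above) auto
    then have "ln (Z y) \<le> ln (real (card S) * exp (v \<bullet> y))"
      using Z[of y] card by (subst ln_le_cancel_iff) auto
    then show "\<exists>x\<in>convex hull S. ln (Z y) \<le> x \<bullet> y + ln (real (card S))"
      using v(1) card by (intro bexI[of _ v]) (auto simp: ln_mult hull_inc)
  qed
  ultimately have "gradient_represents (convex hull S) (\<lambda>y. ln (Z y)) G"
    unfolding gradient_represents_def by blast
  then show ?thesis
    by blast
qed

text \<open>Strict convexity of \<open>u\<close>; it makes the gradient map injective and survives adding further convex
  functions.\<close>

definition strict_tangents :: "('a::euclidean_space \<Rightarrow> real) \<Rightarrow> ('a \<Rightarrow> 'a) \<Rightarrow> bool" where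
  "strict_tangents u G \<longleftrightarrow> (\<forall>x y. x \<noteq> y \<longrightarrow> u x + G x \<bullet> (y - x) < u y)"

lemma strict_tangents_add:
  assumes "strict_tangents u G" and "gradient_represents K v H"
  shows "strict_tangents (\<lambda>x. u x + v x) (\<lambda>x. G x + H x)"
  unfolding strict_tangents_def
proof (intro allI impI)
  fix x y :: 'a
  assume "x \<noteq> y"
  then have "u x + G x \<bullet> (y - x) < u y" "v x + H x \<bullet> (y - x) \<le> v y"
    using assms unfolding strict_tangents_def gradient_represents_def by blast+
  then show "u x + v x + (G x + H x) \<bullet> (y - x) < u y + v y"
    by (simp add: inner_add_left)
qed

lemma strict_tangents_inj:
  assumes "strict_tangents u G"
  shows "inj G"
proof (rule injI, rule ccontr)
  fix x y
  assume "G x = G y" "x \<noteq> y"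
  then have "u x + G x \<bullet> (y - x) < u y" "u y + G x \<bullet> (x - y) < u x"
    using assms unfolding strict_tangents_def by metis+
  then show False
    by (simp add: inner_diff_right)
qed

text \<open>The function \<open>y \<mapsto> r * sqrt (1 + y \<bullet> y)\<close> is a smooth, strictly convex substitute for the support
  function \<open>r \<bar>y\<bar>\<close> of a ball. Adding a small ball to a polytope thus makes its gradient map injective.\<close>

lemma gradient_represents_cball:
  fixes r :: real
  assumes "r > 0"
  shows "\<exists>u G. gradient_represents (cball (0::'a::euclidean_space) r) u G \<and> strict_tangents u G"
proof -
  define s where "s y = sqrt (1 + y \<bullet> y)" for y :: 'a
  define G where "G y = (r * inverse (s y)) *\<^sub>R y" for y :: 'a
  have s_pos: "s y > 0" for y
    by (simp add: s_def add_pos_nonneg)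
  have s_sq: "s y * s y = 1 + y \<bullet> y" for y
    by (simp add: s_def)
  have "G differentiable (at x)" for x
  proof -
    have "1 + x \<bullet> x > 0"
      by (simp add: add_pos_nonneg)
    then have "(s has_derivative (\<lambda>h. (2 * (x \<bullet> h)) * inverse (2 * s x))) (at x)"
      unfolding s_def[abs_def]
      by (auto intro!: derivative_eq_intros simp: inner_commute field_simps)
    then show ?thesis
      unfolding G_def[abs_def] using s_pos[of x]
      by (intro differentiable_scaleR differentiable_mult differentiable_const differentiable_ident
          differentiable_inverse) (auto simp: differentiable_def)
  qed
  moreover have strict: "strict_tangents (\<lambda>x. r * s x) G"
    unfolding strict_tangents_def
  proof (intro allI impI)
    fix x y :: 'a
    assume "x \<noteq> y"
    have "(x \<bullet> y)\<^sup>2 \<le> (x \<bullet> x) * (y \<bullet> y)"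
      by (rule Cauchy_Schwarz_ineq)
    moreover have "0 < (y - x) \<bullet> (y - x)"
      using \<open>x \<noteq> y\<close> by simp
    ultimately have "(1 + x \<bullet> y)\<^sup>2 < (1 + x \<bullet> x) * (1 + y \<bullet> y)"
      by (simp add: power2_eq_square algebra_simps inner_commute)
    also have "\<dots> = (s x * s y)\<^sup>2"
      by (simp add: power2_eq_square s_sq[symmetric] ac_simps)
    finally have lt: "1 + x \<bullet> y < s x * s y"
      using s_pos by (meson less_eq_real_def mult_pos_pos power_less_imp_less_base)
    have "s x * (s x + inverse (s x) * (x \<bullet> (y - x))) = 1 + x \<bullet> y"
      using s_pos[of x] s_sq[of x]
      by (simp add: distrib_left inner_diff_right mult.assoc[symmetric] less_imp_neq[symmetric])
    with lt have "s x * (s x + inverse (s x) * (x \<bullet> (y - x))) < s x * s y"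
      by simp
    then have "s x + inverse (s x) * (x \<bullet> (y - x)) < s y"
      using s_pos[of x] by simp
    then have "r * (s x + inverse (s x) * (x \<bullet> (y - x))) < r * s y"
      using assms by simp
    then show "r * s x + G x \<bullet> (y - x) < r * s y"
      by (simp add: G_def distrib_left)
  qed
  moreover have "\<exists>c. \<forall>y. (\<forall>x\<in>cball 0 r. x \<bullet> y \<le> r * s y + c) \<and>
      (\<exists>x\<in>cball 0 r. r * s y \<le> x \<bullet> y + c)"
  proof (intro exI[of _ r] allI conjI ballI)
    fix y :: 'a
    have norm_le: "norm y \<le> s y"
      unfolding s_def by (intro real_le_rsqrt) (simp add: dot_square_norm)
    have le_norm: "s y \<le> norm y + 1"
      unfolding s_def by (intro real_le_lsqrt) (auto simp: dot_square_norm power2_eq_square algebra_simps)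
    show "x \<bullet> y \<le> r * s y + r" if "x \<in> cball 0 r" for x
    proof -
      have "x \<bullet> y \<le> norm x * norm y"
        by (rule norm_cauchy_schwarz)
      also have "\<dots> \<le> r * s y"
        using that norm_le assms by (intro mult_mono) auto
      finally show ?thesis
        using assms by simp
    qed
    show "\<exists>x\<in>cball 0 r. r * s y \<le> x \<bullet> y + r"
    proof (intro bexI)
      have "sgn y \<bullet> y = norm y"
        by (cases "y = 0") (simp_all add: sgn_div_norm dot_square_norm power2_eq_square)
      moreover have "r * s y \<le> r * (norm y + 1)"
        using le_norm assms by simp
      ultimately show "r * s y \<le> (r *\<^sub>R sgn y) \<bullet> y + r"
        by (simp add: algebra_simps)
      show "r *\<^sub>R sgn y \<in> cball 0 r"
        using assms by (simp add: norm_sgn)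
    qed
  qed
  ultimately have "gradient_represents (cball 0 r) (\<lambda>y. r * s y) G"
    unfolding gradient_represents_def strict_tangents_def
    by (metis add.right_neutral diff_self inner_zero_right less_eq_real_def)
  with strict show ?thesis
    by blast
qed

section \<open>Minkowski polynomiality of the volume\<close>

definition body_vol :: "'a::euclidean_space convex_body \<Rightarrow> real" where
  "body_vol K = measure lebesgue (body_set K)"

lemma body_set_plus: "body_set (K + L) = {x + y | x y. x \<in> body_set K \<and> y \<in> body_set L}"
  by (rule plus_convex_body.rep_eq)

lemma body_vol_mono: "body_set K \<subseteq> body_set L \<Longrightarrow> body_vol K \<le> body_vol L"
  unfolding body_vol_def
  by (intro measure_mono_fmeasurable fmeasurableD lmeasurable_compact body_set_compact)

text \<open>Gradient maps add up along with the bodies that they represent, so the differences of the volume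
  can be taken under the integral sign. The matrix fields \<open>Hs\<close> depend on \<open>Ks\<close> only, which lets the
  induction run over all base bodies \<open>X\<close>.\<close>

lemma idiff_body_vol_integral:
  fixes Ks :: "(real^'m::{finite,wellorder}) convex_body list"
  assumes "\<forall>K\<in>set Ks. \<exists>u G. gradient_represents (body_set K) u G"
  shows "\<exists>Hs. length Hs = length Ks \<and>
    (\<forall>X u G. gradient_represents (body_set X) u G \<longrightarrow> strict_tangents u G \<longrightarrow>
      ((\<lambda>x. idiff det (map (\<lambda>H. H x) Hs) (jacobian G x)) has_integral idiff body_vol Ks X) UNIV)"
  using assms
proof (induction Ks)
  case Nil
  show ?case
    unfolding body_vol_def
    by (auto intro!: measure_gradient_represents body_set_compact body_set_convex strict_tangents_inj)
next
  case (Cons K Ks)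
  then obtain Hs where Hs: "length Hs = length Ks"
    "\<And>X u G. gradient_represents (body_set X) u G \<Longrightarrow> strict_tangents u G \<Longrightarrow>
      ((\<lambda>x. idiff det (map (\<lambda>H. H x) Hs) (jacobian G x)) has_integral idiff body_vol Ks X) UNIV"
    by force
  from Cons.prems obtain v H where K: "gradient_represents (body_set K) v H"
    by auto
  show ?case
  proof (intro exI[of _ "jacobian H # Hs"] conjI allI impI)
    show "length (jacobian H # Hs) = length (K # Ks)"
      using Hs(1) by simp
    fix X :: "(real, 'm) vec convex_body" and u G
    assume X: "gradient_represents (body_set X) u G" "strict_tangents u G"
    have jac: "jacobian (\<lambda>x. G x + H x) x = jacobian G x + jacobian H x" for x
      using X(1) K unfolding gradient_represents_def by (blast intro: jacobian_add)
    have "gradient_represents (body_set (X + K)) (\<lambda>x. u x + v x) (\<lambda>x. G x + H x)"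
      unfolding body_set_plus by (rule gradient_represents_add[OF X(1) K])
    from Hs(2)[OF this strict_tangents_add[OF X(2) K]] Hs(2)[OF X]
    show "((\<lambda>x. idiff det (map (\<lambda>H. H x) (jacobian H # Hs)) (jacobian G x))
        has_integral idiff body_vol (K # Ks) X) UNIV"
      unfolding jac by (simp add: has_integral_diff)
  qed
qed

lemma idiff_body_vol_eq_0_represented:
  fixes Ks :: "(real^'m::{finite,wellorder}) convex_body list"
  assumes "\<forall>K\<in>set Ks. \<exists>u G. gradient_represents (body_set K) u G"
    and "gradient_represents (body_set X) u G" "strict_tangents u G"
    and "length Ks = Suc CARD('m)"
  shows "idiff body_vol Ks X = 0"
proof -
  obtain Hs where "length Hs = length Ks"
    "((\<lambda>x. idiff det (map (\<lambda>H. H x) Hs) (jacobian G x)) has_integral idiff body_vol Ks X) UNIV"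
    using idiff_body_vol_integral[OF assms(1)] assms(2,3) by blast
  moreover from this(1) have "idiff det (map (\<lambda>H. H x) Hs) (jacobian G x) = 0" for x
    using idiff_vanish_det[where 'n = 'm] assms(4) by (simp add: idiff_vanish_def)
  ultimately show ?thesis
    by (metis (no_types, lifting) ext has_integral_0 has_integral_unique)
qed

text \<open>Approximation from outside, in a form that is stable under Minkowski addition; from outside, the
  volume converges by mere continuity of the measure from above.\<close>

definition outer_limit :: "(nat \<Rightarrow> 'a::euclidean_space convex_body) \<Rightarrow> 'a convex_body \<Rightarrow> bool" where
  "outer_limit B A \<longleftrightarrow> (\<exists>r. r \<longlonglongrightarrow> 0 \<and> (\<forall>m. body_set A \<subseteq> body_set (B m) \<and>
     (\<forall>x\<in>body_set (B m). \<exists>a\<in>body_set A. dist x a \<le> r m)))"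

lemma outer_limit_add:
  assumes "outer_limit B A" "outer_limit B' A'"
  shows "outer_limit (\<lambda>m. B m + B' m) (A + A')"
proof -
  obtain r where r_lim: "r \<longlonglongrightarrow> 0"
    and r_bounds: "\<forall>m. body_set A \<subseteq> body_set (B m) \<and>
      (\<forall>x\<in>body_set (B m). \<exists>a\<in>body_set A. dist x a \<le> r m)"
    using assms(1) unfolding outer_limit_def by (elim exE conjE)
  note r = r_lim r_bounds[THEN spec, THEN conjunct1] r_bounds[THEN spec, THEN conjunct2, rule_format]
  obtain s where s_lim: "s \<longlonglongrightarrow> 0"
    and s_bounds: "\<forall>m. body_set A' \<subseteq> body_set (B' m) \<and>
      (\<forall>x\<in>body_set (B' m). \<exists>a\<in>body_set A'. dist x a \<le> s m)"
    using assms(2) unfolding outer_limit_def by (elim exE conjE)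
  note s = s_lim s_bounds[THEN spec, THEN conjunct1] s_bounds[THEN spec, THEN conjunct2, rule_format]
  have "\<exists>c\<in>body_set (A + A'). dist z c \<le> r m + s m" if zB: "z \<in> body_set (B m + B' m)" for z m
  proof -
    obtain x y where z: "z = x + y" "x \<in> body_set (B m)" "y \<in> body_set (B' m)"
      using zB unfolding body_set_plus by blast
    obtain a b where "a \<in> body_set A" "b \<in> body_set A'" "dist x a \<le> r m" "dist y b \<le> s m"
      using r(3)[OF z(2)] s(3)[OF z(3)] by blast
    then show ?thesis
      using dist_triangle_add[of x y a b] by (intro bexI[of _ "a + b"]) (auto simp: z body_set_plus)
  qed
  moreover have "body_set (A + A') \<subseteq> body_set (B m + B' m)" for m
    using r(2) s(2) unfolding body_set_plus by blast
  moreover have "(\<lambda>m. r m + s m) \<longlonglongrightarrow> 0"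
    using tendsto_add[OF r(1) s(1)] by simp
  ultimately show ?thesis
    unfolding outer_limit_def by blast
qed

lemma outer_limit_body_vol:
  assumes "outer_limit B A"
  shows "(\<lambda>m. body_vol (B m)) \<longlonglongrightarrow> body_vol A"
proof -
  obtain r where r_lim: "r \<longlonglongrightarrow> 0"
    and r_bounds: "\<forall>m. body_set A \<subseteq> body_set (B m) \<and>
      (\<forall>x\<in>body_set (B m). \<exists>a\<in>body_set A. dist x a \<le> r m)"
    using assms unfolding outer_limit_def by (elim exE conjE)
  note r = r_lim r_bounds[THEN spec, THEN conjunct1] r_bounds[THEN spec, THEN conjunct2, rule_format]
  define N where "N j = {x. infdist x (body_set A) \<le> inverse (real (Suc j))}" for j
  have ne: "body_set A \<noteq> {}"
    by (rule body_set_nonempty)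
  have compact: "compact (N j)" for j
    unfolding N_def using compact_infdist_le[OF ne body_set_compact, of "inverse (real (Suc j))"] by simp
  have "decseq N"
    unfolding decseq_def N_def by (auto elim!: order_trans intro!: le_imp_inverse_le)
  moreover have "(\<Inter>j. N j) = body_set A"
  proof
    show "(\<Inter>j. N j) \<subseteq> body_set A"
    proof
      fix x
      assume "x \<in> (\<Inter>j. N j)"
      then have "infdist x (body_set A) \<le> inverse (real (Suc j))" for j
        unfolding N_def by blast
      then have "infdist x (body_set A) \<le> 0"
        using LIMSEQ_le_const[OF LIMSEQ_inverse_real_of_nat] by blast
      then have "infdist x (body_set A) = 0"
        by (intro order_antisym infdist_nonneg)
      then show "x \<in> body_set A"
        using in_closed_iff_infdist_zero[OF compact_imp_closed[OF body_set_compact] ne] by blast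
    qed
  qed (auto simp: N_def)
  ultimately have lim: "(\<lambda>j. measure lebesgue (N j)) \<longlonglongrightarrow> body_vol A"
    using Lim_measure_decseq[of N lebesgue] fmeasurableD[OF lmeasurable_compact[OF compact]]
      fmeasurableD2[OF lmeasurable_compact[OF compact]]
    by (simp add: body_vol_def image_subset_iff)
  show ?thesis
  proof (rule LIMSEQ_I)
    fix e :: real
    assume "e > 0"
    then obtain j where "measure lebesgue (N j) < body_vol A + e"
      using order_tendstoD(2)[OF lim, of "body_vol A + e"] by (auto simp: eventually_sequentially)
    moreover obtain m0 where m0: "\<And>m. m \<ge> m0 \<Longrightarrow> r m < inverse (real (Suc j))"
      using order_tendstoD(2)[OF r(1), of "inverse (real (Suc j))"]
      by (auto simp: eventually_sequentially)
    moreover have "body_vol (B m) \<le> measure lebesgue (N j)" if "m \<ge> m0" for m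
    proof -
      have "body_set (B m) \<subseteq> N j"
      proof
        fix x assume "x \<in> body_set (B m)"
        then obtain a where "a \<in> body_set A" "dist x a \<le> r m"
          using r(3) by blast
        then have "infdist x (body_set A) \<le> r m"
          using infdist_le2 by blast
        with m0[OF that] show "x \<in> N j"
          by (simp add: N_def)
      qed
      then show ?thesis
        unfolding body_vol_def
        by (intro measure_mono_fmeasurable fmeasurableD lmeasurable_compact body_set_compact compact)
    qed
    moreover have "body_vol A \<le> body_vol (B m)" for m
      by (rule body_vol_mono[OF r(2)])
    ultimately have "norm (body_vol (B m) - body_vol A) < e" if "m \<ge> m0" for m
      using that by (smt (verit, best) real_norm_def)
    then show "\<exists>m0. \<forall>m\<ge>m0. norm (body_vol (B m) - body_vol A) < e"
      by blast
  qed
qed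

lemma outer_limit_idiff_body_vol:
  assumes "\<And>K. K \<in> set Ks \<Longrightarrow> outer_limit (P K) K" and "outer_limit Y X"
  shows "(\<lambda>m. idiff body_vol (map (\<lambda>K. P K m) Ks) (Y m)) \<longlonglongrightarrow> idiff body_vol Ks X"
  using assms
proof (induction Ks arbitrary: X Y)
  case Nil
  then show ?case
    by (simp add: outer_limit_body_vol)
next
  case (Cons K Ks)
  then have "outer_limit (P K) K"
    by simp
  from outer_limit_add[OF Cons.prems(2) this] Cons.prems Cons.IH show ?case
    by (simp add: tendsto_diff)
qed

text \<open>A finite \<open>r\<close>-net of \<open>K\<close> spans a polytope inside \<open>K\<close>, and adding a ball of radius \<open>r\<close> to it covers \<open>K\<close>.\<close>

lemma represented_outer_neighbour:
  fixes K :: "'a::euclidean_space convex_body"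
  assumes "r > 0"
  shows "\<exists>P u G. body_set K \<subseteq> body_set P \<and> (\<forall>x\<in>body_set P. \<exists>a\<in>body_set K. dist x a \<le> r) \<and>
    gradient_represents (body_set P) u G \<and> strict_tangents u G"
proof -
  have "body_set K \<subseteq> (\<Union>s\<in>body_set K. ball s r)"
    using \<open>r > 0\<close> by force
  then obtain S where S: "finite S" "S \<subseteq> body_set K" "body_set K \<subseteq> (\<Union>s\<in>S. ball s r)"
    using compactE_image[OF body_set_compact, of "body_set K" "\<lambda>s. ball s r"] by (metis open_ball)
  then have "S \<noteq> {}"
    using body_set_nonempty[of K] by auto
  have hull: "body_set (Body (convex hull S)) = convex hull S"
    using S(1) \<open>S \<noteq> {}\<close> by (intro Body_inverse) (simp add: finite_imp_compact_convex_hull)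
  have ball: "body_set (Body (cball (0::'a) r)) = cball 0 r"
    using \<open>r > 0\<close> by (intro Body_inverse) simp
  obtain u G where u: "gradient_represents (convex hull S) u G"
    using gradient_represents_convex_hull[OF S(1) \<open>S \<noteq> {}\<close>] by blast
  obtain v H where v: "gradient_represents (cball (0::'a) r) v H" "strict_tangents v H"
    using gradient_represents_cball[OF \<open>r > 0\<close>] by blast
  define P where "P = Body (cball (0::'a) r) + Body (convex hull S)"
  have P: "body_set P = {x + y |x y. x \<in> cball 0 r \<and> y \<in> convex hull S}"
    by (simp add: P_def body_set_plus hull ball)
  have "gradient_represents (body_set P) (\<lambda>x. v x + u x) (\<lambda>x. H x + G x)"
    unfolding P by (rule gradient_represents_add[OF v(1) u])
  moreover have "strict_tangents (\<lambda>x. v x + u x) (\<lambda>x. H x + G x)"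
    by (rule strict_tangents_add[OF v(2) u])
  moreover have "body_set K \<subseteq> body_set P"
  proof
    fix x assume "x \<in> body_set K"
    then obtain s where "s \<in> S" "dist s x < r"
      using S(3) by auto
    then have "x - s \<in> cball 0 r" "s \<in> convex hull S"
      by (auto simp: dist_norm norm_minus_commute hull_inc)
    then show "x \<in> body_set P"
      unfolding P by (intro CollectI exI[of _ "x - s"] exI[of _ s]) simp
  qed
  moreover have "\<exists>a\<in>body_set K. dist x a \<le> r" if x: "x \<in> body_set P" for x
  proof -
    obtain y z where "x = y + z" "y \<in> cball 0 r" "z \<in> convex hull S"
      using x unfolding P by blast
    moreover have "convex hull S \<subseteq> body_set K"
      by (intro hull_minimal S(2) body_set_convex)
    ultimately show ?thesis
      by (intro bexI[of _ z]) (auto simp: dist_norm)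
  qed
  ultimately show ?thesis
    by blast
qed

lemma idiff_body_vol_eq_0_wellorder:
  fixes Ks :: "(real^'m::{finite,wellorder}) convex_body list"
  assumes "length Ks = Suc CARD('m)"
  shows "idiff body_vol Ks X = 0"
proof -
  have "\<forall>K::(real, 'm) vec convex_body. \<forall>m. \<exists>P. body_set K \<subseteq> body_set P \<and>
      (\<forall>x\<in>body_set P. \<exists>a\<in>body_set K. dist x a \<le> inverse (real (Suc m))) \<and>
      (\<exists>u G. gradient_represents (body_set P) u G \<and> strict_tangents u G)"
    using represented_outer_neighbour[of "inverse (real (Suc m))" for m]
    by (metis inverse_positive_iff_positive of_nat_0_less_iff zero_less_Suc)
  then obtain P :: "(real, 'm) vec convex_body \<Rightarrow> nat \<Rightarrow> (real, 'm) vec convex_body" where P: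
    "\<And>K m. body_set K \<subseteq> body_set (P K m)"
    "\<And>K m x. x \<in> body_set (P K m) \<Longrightarrow> \<exists>a\<in>body_set K. dist x a \<le> inverse (real (Suc m))"
    "\<And>K m. \<exists>u G. gradient_represents (body_set (P K m)) u G \<and> strict_tangents u G"
    by metis
  have "outer_limit (P K) K" for K
    unfolding outer_limit_def using P(1,2) LIMSEQ_inverse_real_of_nat by blast
  then have "(\<lambda>m. idiff body_vol (map (\<lambda>K. P K m) Ks) (P X m)) \<longlonglongrightarrow> idiff body_vol Ks X"
    by (intro outer_limit_idiff_body_vol)
  moreover have "idiff body_vol (map (\<lambda>K. P K m) Ks) (P X m) = 0" for m
  proof -
    obtain u G where "gradient_represents (body_set (P X m)) u G" "strict_tangents u G"
      using P(3) by blast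
    moreover have "\<forall>K\<in>set (map (\<lambda>K. P K m) Ks). \<exists>u G. gradient_represents (body_set K) u G"
      unfolding set_map using P(3) by blast
    ultimately show ?thesis
      using assms by (intro idiff_body_vol_eq_0_represented) auto
  qed
  ultimately show ?thesis
    by (simp add: LIMSEQ_const_iff)
qed

text \<open>A copy of a finite index type, well-ordered by an enumeration; the change of variables formula is
  applied in these ordered coordinates. Permuting coordinates preserves volume, so the outcome carries
  over to the original index type.\<close>

typedef (overloaded) ('n::finite) ranked = "{..<CARD('n)}"
  by (rule exI[of _ 0]) (simp add: lessThan_iff)

lemma finite_UNIV_ranked: "finite (UNIV :: 'n::finite ranked set)"
  and card_ranked: "CARD('n::finite ranked) = CARD('n)"
proof -
  interpret type_definition "Rep_ranked :: 'n ranked \<Rightarrow> nat" Abs_ranked "{..<CARD('n)}"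
    by (rule type_definition_ranked)
  show "finite (UNIV :: 'n ranked set)"
    by (simp add: univ)
  show "CARD('n ranked) = CARD('n)"
    by (simp add: card)
qed

instantiation ranked :: (finite) "{finite, wellorder}"
begin

definition less_eq_ranked :: "'a ranked \<Rightarrow> 'a ranked \<Rightarrow> bool" where
  "less_eq_ranked i j \<longleftrightarrow> Rep_ranked i \<le> Rep_ranked j"

definition less_ranked :: "'a ranked \<Rightarrow> 'a ranked \<Rightarrow> bool" where
  "less_ranked i j \<longleftrightarrow> Rep_ranked i < Rep_ranked j"

instance
proof
  show "finite (UNIV :: 'a ranked set)"
    by (rule finite_UNIV_ranked)
  fix P :: "'a ranked \<Rightarrow> bool" and i :: "'a ranked"
  assume step: "\<And>i. (\<And>j. j < i \<Longrightarrow> P j) \<Longrightarrow> P i"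
  show "P i"
    by (induction i rule: measure_induct_rule[of Rep_ranked]) (auto intro: step simp: less_ranked_def)
qed (auto simp: less_eq_ranked_def less_ranked_def Rep_ranked_inject)

end

lemma ranked_bij: "\<exists>f :: 'n::finite ranked \<Rightarrow> 'n. bij f"
  using finite_same_card_bij[of "UNIV :: 'n ranked set" "UNIV :: 'n set"] by (auto simp: card_ranked)

text \<open>The map permutes the edge lengths of boxes, and the Lebesgue measure is determined by its values on
  boxes.\<close>

lemma measure_reindex_coordinates:
  fixes f :: "'m::finite \<Rightarrow> 'n::finite" and K :: "(real^'n) set"
  assumes f: "bij f" and K: "compact K"
  shows "measure lebesgue ((\<lambda>x. \<chi> i. x $ f i) ` K) = measure lebesgue K"
proof -
  define T :: "real^'n \<Rightarrow> real^'m" where "T x = (\<chi> i. x $ f i)" for x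
  define g where "g = inv f"
  have fg: "f (g j) = j" "g (f i) = i" for i j
    using f by (simp_all add: g_def bij_is_surj surj_f_inv_f bij_is_inj)
  have "linear T"
    by (rule linearI) (auto simp: T_def vec_eq_iff)
  then have cont: "continuous_on UNIV T"
    by (simp add: linear_continuous_on linear_conv_bounded_linear)
  then have meas: "T \<in> borel_measurable lborel"
    by (simp add: borel_measurable_continuous_onI)
  have "lborel = distr lborel borel T"
  proof (rule lborel_eqI)
    fix l u :: "real^'m"
    assume le: "\<And>b. b \<in> Basis \<Longrightarrow> l \<bullet> b \<le> u \<bullet> b"
    have "l $ i \<le> u $ i" for i
      using le[of "axis i 1"] by (simp add: inner_axis axis_in_Basis_iff)
    then have le': "\<And>b. b \<in> Basis \<Longrightarrow> (\<chi> j. l $ g j) \<bullet> b \<le> (\<chi> j. u $ g j) \<bullet> b"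
      by (auto simp: Basis_vec_def inner_axis)
    have prod: "(\<Prod>b\<in>Basis. v \<bullet> b) = (\<Prod>i\<in>UNIV. v $ i)" for v :: "real^'k"
    proof -
      have B: "Basis = range (\<lambda>i::'k. axis i (1::real))"
        by (auto simp: Basis_vec_def)
      have "inj (\<lambda>i::'k. axis i (1::real))"
        by (auto simp: inj_def axis_eq_axis)
      then show ?thesis
        unfolding B by (subst prod.reindex) (simp_all add: inner_axis)
    qed
    have "T -` box l u = box (\<chi> j. l $ g j) (\<chi> j. u $ g j)"
    proof (rule set_eqI)
      fix x
      have "(\<forall>i. l $ i < x $ f i \<and> x $ f i < u $ i) \<longleftrightarrow> (\<forall>j. l $ g j < x $ j \<and> x $ j < u $ g j)"
        using fg by metis
      then show "x \<in> T -` box l u \<longleftrightarrow> x \<in> box (\<chi> j. l $ g j) (\<chi> j. u $ g j)"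
        by (simp add: T_def mem_box_cart)
    qed
    then have "emeasure (distr lborel borel T) (box l u) =
        emeasure lborel (box (\<chi> j. l $ g j) (\<chi> j. u $ g j))"
      using meas by (simp add: emeasure_distr)
    also have "\<dots> = ennreal (\<Prod>j\<in>UNIV. (u - l) $ g j)"
      using le' by (simp add: emeasure_lborel_box prod)
    also have "(\<Prod>j\<in>UNIV. (u - l) $ g j) = (\<Prod>i\<in>UNIV. (u - l) $ i)"
      using fg by (intro prod.reindex_bij_witness[of _ f g]) auto
    finally show "emeasure (distr lborel borel T) (box l u) = ennreal (\<Prod>b\<in>Basis. (u - l) \<bullet> b)"
      by (simp add: prod)
  qed simp
  then have "measure lborel (T ` K) = measure (distr lborel borel T) (T ` K)"
    by (rule arg_cong)
  moreover have TK: "T ` K \<in> sets borel"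
    using K by (intro borel_compact compact_continuous_image continuous_on_subset[OF cont]) auto
  ultimately have "measure lborel (T ` K) = measure lborel (T -` T ` K)"
    using measure_distr[of T lborel borel "T ` K"] meas by simp
  also have "T -` T ` K = K"
  proof (rule inj_vimage_image_eq, rule injI)
    fix x y
    assume "T x = T y"
    then have "x $ f (g j) = y $ f (g j)" for j
      unfolding T_def vec_eq_iff by (simp del: fg)
    then show "x = y"
      by (simp add: fg vec_eq_iff)
  qed
  finally show ?thesis
    using TK K by (simp add: T_def borel_compact)
qed

lemma body_eqI: "body_set K = body_set L \<Longrightarrow> K = L"
  by (simp add: body_set_inject)

definition linear_image_body ::
  "('a::euclidean_space \<Rightarrow> 'b::euclidean_space) \<Rightarrow> 'a convex_body \<Rightarrow> 'b convex_body" where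
  "linear_image_body h K = Body (h ` body_set K)"

lemma body_set_linear_image:
  assumes "linear h"
  shows "body_set (linear_image_body h K) = h ` body_set K"
  unfolding linear_image_body_def using assms
  by (intro Body_inverse)
     (simp add: body_set_nonempty convex_linear_image body_set_compact body_set_convex
       compact_continuous_image linear_continuous_on linear_conv_bounded_linear)

lemma linear_image_body_plus:
  assumes "linear h"
  shows "linear_image_body h (K + L) = linear_image_body h K + linear_image_body h L"
proof (rule body_eqI)
  show "body_set (linear_image_body h (K + L)) = body_set (linear_image_body h K + linear_image_body h L)"
    unfolding body_set_linear_image[OF assms] body_set_plus
    by (auto simp: linear_add[OF assms] image_iff) (metis linear_add[OF assms])+
qed

text \<open>In other words, the volume of a Minkowski sum is a polynomial of degree at most \<open>n\<close> in its summands.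
  The multilinearity of mixed volumes rests on this fact.\<close>

theorem idiff_body_vol_eq_0:
  fixes Ks :: "(real^'n) convex_body list"
  assumes "length Ks = Suc CARD('n)"
  shows "idiff body_vol Ks X = 0"
proof -
  obtain f :: "'n ranked \<Rightarrow> 'n" where f: "bij f"
    using ranked_bij by blast
  define t :: "real^'n \<Rightarrow> real^'n ranked" where "t x = (\<chi> i. x $ f i)" for x
  have lin: "linear t"
    by (rule linearI) (auto simp: t_def vec_eq_iff)
  have "body_vol (linear_image_body t K) = body_vol K" for K
    unfolding body_vol_def body_set_linear_image[OF lin]
    using measure_reindex_coordinates[OF f body_set_compact] by (simp add: t_def[abs_def])
  then have "idiff body_vol Ks X =
      idiff body_vol (map (linear_image_body t) Ks) (linear_image_body t X)"
    by (induction Ks arbitrary: X) (simp_all add: linear_image_body_plus[OF lin])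
  also have "\<dots> = 0"
    using assms by (intro idiff_body_vol_eq_0_wellorder) (simp add: card_ranked)
  finally show ?thesis .
qed

section \<open>Arithmetic of convex bodies and multilinearity of the polarized volume\<close>

lemma body_set_scaleR: "body_set (t *\<^sub>R K) = (\<lambda>x. t *\<^sub>R x) ` body_set K"
  by (rule scaleR_convex_body.rep_eq)

lemma body_set_zero: "body_set (0 :: 'a::euclidean_space convex_body) = {0}"
  by (rule zero_convex_body.rep_eq)

lemma body_scale_zero: "0 *\<^sub>R K = (0 :: 'a::euclidean_space convex_body)"
  by (rule body_eqI) (auto simp: body_set_scaleR body_set_zero body_set_nonempty image_constant_conv)

lemma body_scale_one: "1 *\<^sub>R K = (K :: 'a::euclidean_space convex_body)"
  by (rule body_eqI) (simp add: body_set_scaleR)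

lemma body_scale_add: "t *\<^sub>R (K + L) = t *\<^sub>R K + t *\<^sub>R (L :: 'a::euclidean_space convex_body)"
proof (rule body_eqI, rule antisym)
  show "body_set (t *\<^sub>R (K + L)) \<subseteq> body_set (t *\<^sub>R K + t *\<^sub>R L)"
    unfolding body_set_scaleR body_set_plus by (fastforce simp: scaleR_add_right)
  show "body_set (t *\<^sub>R K + t *\<^sub>R L) \<subseteq> body_set (t *\<^sub>R (K + L))"
    unfolding body_set_scaleR body_set_plus by (fastforce simp: scaleR_add_right[symmetric])
qed

text \<open>This is where convexity is used: the weights \<open>s / (s + t)\<close> and \<open>t / (s + t)\<close> turn \<open>s x + t y\<close> into a
  multiple of a point of \<open>K\<close>.\<close>

lemma body_add_scale:
  fixes K :: "'a::euclidean_space convex_body"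
  assumes "0 \<le> s" "0 \<le> t"
  shows "(s + t) *\<^sub>R K = s *\<^sub>R K + t *\<^sub>R K"
proof (cases "s + t = 0")
  case True
  with assms have "s = 0" "t = 0"
    by auto
  then show ?thesis
    by (simp add: body_scale_zero)
next
  case False
  then have pos: "s + t > 0"
    using assms by simp
  show ?thesis
  proof (rule body_eqI, rule antisym)
    show "body_set ((s + t) *\<^sub>R K) \<subseteq> body_set (s *\<^sub>R K + t *\<^sub>R K)"
      unfolding body_set_scaleR body_set_plus by (fastforce simp: scaleR_add_left)
    show "body_set (s *\<^sub>R K + t *\<^sub>R K) \<subseteq> body_set ((s + t) *\<^sub>R K)"
    proof
      fix z
      assume "z \<in> body_set (s *\<^sub>R K + t *\<^sub>R K)"
      then obtain x y where z: "z = s *\<^sub>R x + t *\<^sub>R y" "x \<in> body_set K" "y \<in> body_set K"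
        unfolding body_set_scaleR body_set_plus by blast
      have "(s / (s + t)) *\<^sub>R x + (t / (s + t)) *\<^sub>R y \<in> body_set K"
        using z assms pos body_set_convex[of K]
        by (intro convexD) (simp_all add: add_divide_distrib[symmetric])
      moreover have "z = (s + t) *\<^sub>R ((s / (s + t)) *\<^sub>R x + (t / (s + t)) *\<^sub>R y)"
        using pos by (simp add: z scaleR_add_right)
      ultimately show "z \<in> body_set ((s + t) *\<^sub>R K)"
        unfolding body_set_scaleR by blast
    qed
  qed
qed

lemma body_set_plus_subset_cball:
  assumes "body_set K \<subseteq> cball 0 r" "body_set L \<subseteq> cball 0 s"
  shows "body_set (K + L) \<subseteq> cball (0::'a::euclidean_space) (r + s)"
proof
  fix z assume "z \<in> body_set (K + L)"
  then obtain x y where "z = x + y" "x \<in> body_set K" "y \<in> body_set L"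
    unfolding body_set_plus by blast
  then show "z \<in> cball 0 (r + s)"
    using assms norm_triangle_ineq[of x y] by force
qed

lemma body_set_scale_subset_cball:
  assumes "body_set K \<subseteq> cball 0 r" "0 \<le> t"
  shows "body_set (t *\<^sub>R K) \<subseteq> cball (0::'a::euclidean_space) (t * r)"
  using assms by (force simp: body_set_scaleR mult_left_mono)

lemma body_vol_nonneg: "0 \<le> body_vol K"
  by (simp add: body_vol_def)

lemma body_vol_le_cball:
  "body_set K \<subseteq> cball (0::'a) r \<Longrightarrow> body_vol K \<le> measure lebesgue (cball (0::'a::euclidean_space) r)"
  unfolding body_vol_def
  by (rule measure_mono_fmeasurable)
     (auto intro!: fmeasurableD lmeasurable_compact body_set_compact)

lemma idiff_body_vol_bound:
  fixes Ks :: "'a::euclidean_space convex_body list"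
  assumes "\<forall>K\<in>set Ks. body_set K \<subseteq> cball 0 R" "body_set X \<subseteq> cball 0 r" "0 \<le> R"
  shows "\<bar>idiff body_vol Ks X\<bar> \<le> 2 ^ length Ks * measure lebesgue (cball (0::'a) (r + real (length Ks) * R))"
  using assms
proof (induction Ks arbitrary: X r)
  case Nil
  then show ?case
    using body_vol_le_cball[of X r] body_vol_nonneg[of X] by simp
next
  case (Cons K Ks)
  let ?m = "\<lambda>r. measure lebesgue (cball (0::'a) r)"
  have "body_set (X + K) \<subseteq> cball 0 (r + R)"
    using Cons.prems by (intro body_set_plus_subset_cball) auto
  then have "\<bar>idiff body_vol Ks (X + K)\<bar> \<le> 2 ^ length Ks * ?m (r + R + real (length Ks) * R)"
    using Cons by auto
  moreover have "\<bar>idiff body_vol Ks X\<bar> \<le> 2 ^ length Ks * ?m (r + real (length Ks) * R)"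
    using Cons by auto
  moreover have "?m (r + real (length Ks) * R) \<le> ?m (r + R + real (length Ks) * R)"
    using Cons.prems by (intro measure_mono_fmeasurable) (auto intro: fmeasurableD)
  then have "2 ^ length Ks * ?m (r + real (length Ks) * R) \<le> 2 ^ length Ks * ?m (r + R + real (length Ks) * R)"
    by (rule mult_left_mono) simp
  ultimately have "\<bar>idiff body_vol (K # Ks) X\<bar> \<le> 2 * (2 ^ length Ks * ?m (r + R + real (length Ks) * R))"
    unfolding idiff.simps by linarith
  moreover have "r + real (length (K # Ks)) * R = r + R + real (length Ks) * R"
    by (simp add: algebra_simps)
  ultimately show ?case
    by (simp only: length_Cons power_Suc mult.assoc)
qed

text \<open>The difference to a linear function is additive and has period \<open>1\<close>, hence is bounded on the whole
  half-line; a bounded additive function is zero.\<close>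

lemma additive_bounded_imp_linear:
  fixes g :: "real \<Rightarrow> real"
  assumes add: "\<And>s t. 0 \<le> s \<Longrightarrow> 0 \<le> t \<Longrightarrow> g (s + t) = g s + g t"
    and bound: "\<And>t. 0 \<le> t \<Longrightarrow> t \<le> 1 \<Longrightarrow> \<bar>g t\<bar> \<le> C" and "0 \<le> t"
  shows "g t = t * g 1"
proof -
  define h where "h t = g t - t * g 1" for t
  have h_add: "h (s + t) = h s + h t" if "0 \<le> s" "0 \<le> t" for s t
    using that by (simp add: h_def add algebra_simps)
  have h_mult: "h (real m * t) = real m * h t" if "0 \<le> t" for m t
  proof (induction m)
    case 0
    show ?case
      using h_add[of 0 0] by simp
  next
    case (Suc m)
    then show ?case
      using h_add[of t "real m * t"] that by (simp add: algebra_simps)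
  qed
  have h_bound: "\<bar>h t\<bar> \<le> C + \<bar>g 1\<bar>" if "0 \<le> t" for t
  proof -
    define m where "m = nat \<lfloor>t\<rfloor>"
    have m: "real m \<le> t" "t - real m \<le> 1"
      using that unfolding m_def by linarith+
    have "h t = h (real m * 1) + h (t - real m)"
      using h_add[of "real m" "t - real m"] m by simp
    also have "\<dots> = h (t - real m)"
      unfolding h_mult[OF zero_le_one] by (simp add: h_def)
    also have "\<bar>\<dots>\<bar> \<le> \<bar>g (t - real m)\<bar> + \<bar>t - real m\<bar> * \<bar>g 1\<bar>"
      unfolding h_def by (simp add: abs_mult[symmetric])
    also have "\<dots> \<le> C + 1 * \<bar>g 1\<bar>"
      using m by (intro add_mono bound mult_right_mono) auto
    finally show ?thesis by simp
  qed
  have "h t = 0"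
  proof (rule ccontr)
    assume "h t \<noteq> 0"
    then obtain m where "C + \<bar>g 1\<bar> < real m * \<bar>h t\<bar>"
      using reals_Archimedean3[of "\<bar>h t\<bar>"] by auto
    then show False
      using h_bound[of "real m * t"] \<open>0 \<le> t\<close> by (simp add: h_mult abs_mult)
  qed
  then show ?thesis
    by (simp add: h_def)
qed

text \<open>The polarization formula \<open>n! V(K\<^sub>1, \<dots>, K\<^sub>n) = (\<Sum>S. (-1)^(n - \<bar>S\<bar>) vol(\<Sum>i\<in>S. K\<^sub>i))\<close>.\<close>

definition polarized_vol :: "(real^'n) convex_body list \<Rightarrow> real" where
  "polarized_vol Ks = idiff body_vol Ks 0 / fact CARD('n)"

lemma polarized_vol_mset: "mset Ks = mset Ls \<Longrightarrow> polarized_vol Ks = polarized_vol Ls"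
  unfolding polarized_vol_def using idiff_mset by metis

lemma idiff_body_vol_add:
  fixes Ls :: "(real^'n) convex_body list"
  assumes "Suc (length Ls) = CARD('n)"
  shows "idiff body_vol ((K + L) # Ls) X = idiff body_vol (K # Ls) X + idiff body_vol (L # Ls) X"
proof -
  have "idiff body_vol (K # L # Ls) X = 0"
    using assms by (intro idiff_body_vol_eq_0) simp
  then show ?thesis
    by (simp add: ac_simps)
qed

text \<open>The defect of additivity is an \<open>(n + 1)\<close>-fold difference of the volume.\<close>

lemma polarized_vol_add:
  fixes Ls :: "(real^'n) convex_body list"
  assumes "Suc (length Ls) = CARD('n)"
  shows "polarized_vol ((K + L) # Ls) = polarized_vol (K # Ls) + polarized_vol (L # Ls)"
  unfolding polarized_vol_def idiff_body_vol_add[OF assms] by (rule add_divide_distrib)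

lemma body_subset_cball: "\<exists>r>0. body_set K \<subseteq> cball 0 r"
  using compact_imp_bounded[OF body_set_compact, of K] unfolding bounded_pos
  by (auto simp: subset_iff)

lemma bodies_subset_cball:
  "finite F \<Longrightarrow> \<exists>r>0. \<forall>K\<in>F. body_set K \<subseteq> cball (0::'a::euclidean_space) r"
proof (induction rule: finite_induct)
  case (insert K F)
  then obtain r s where "r > 0" "s > 0" "\<forall>L\<in>F. body_set L \<subseteq> cball 0 r" "body_set K \<subseteq> cball 0 s"
    using body_subset_cball by metis
  then show ?case
    by (intro exI[of _ "max r s"]) (auto simp: subset_iff le_max_iff_disj)
qed (auto intro: exI[of _ 1])

text \<open>Additivity gives rational factors; as iterated differences are bounded on bounded sets, it extends to
  all nonnegative factors.\<close>

lemma polarized_vol_scale: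
  fixes Ls :: "(real^'n) convex_body list"
  assumes len: "Suc (length Ls) = CARD('n)" and "0 \<le> t"
  shows "polarized_vol ((t *\<^sub>R K) # Ls) = t * polarized_vol (K # Ls)"
proof -
  obtain r where r: "r > 0" "\<forall>L\<in>set (K # Ls). body_set L \<subseteq> cball 0 r"
    using bodies_subset_cball[of "set (K # Ls)"] by auto
  define g where "g t = idiff body_vol ((t *\<^sub>R K) # Ls) 0" for t
  have "g t = t * g 1"
  proof (rule additive_bounded_imp_linear)
    show "g (s + t) = g s + g t" if "0 \<le> s" "0 \<le> t" for s t
      unfolding g_def body_add_scale[OF that] by (rule idiff_body_vol_add[OF len])
    show "\<bar>g t\<bar> \<le> 2 ^ length (K # Ls) *
        measure lebesgue (cball (0::real^'n) (0 + real (length (K # Ls)) * r))"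
      if t: "0 \<le> t" "t \<le> 1" for t
    proof -
      have "body_set (t *\<^sub>R K) \<subseteq> cball 0 (t * r)"
        using r(2) t by (intro body_set_scale_subset_cball) auto
      also have "\<dots> \<subseteq> cball 0 r"
        using t r(1) by (intro subset_cball) (simp add: mult_left_le_one_le)
      finally show ?thesis
        unfolding g_def
        using r idiff_body_vol_bound[of "(t *\<^sub>R K) # Ls" r 0 0] by (simp add: body_set_zero)
    qed
  qed fact
  then show ?thesis
    unfolding g_def polarized_vol_def by (simp add: body_scale_one del: idiff.simps)
qed

text \<open>Differences in the direction of a single body are ordinary differences, with step \<open>1\<close>, of the function
  on the ray that the body generates.\<close>

lemma idiff_replicate_ray:
  fixes K :: "'a::euclidean_space convex_body"
  assumes "\<And>t. 0 \<le> t \<Longrightarrow> f (t *\<^sub>R K + Y) = p t" "0 \<le> x"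
  shows "idiff f (replicate m K) (x *\<^sub>R K + Y) = idiff p (replicate m 1) x"
  using assms(2)
proof (induction m arbitrary: x)
  case 0
  then show ?case
    by (simp add: assms(1))
next
  case (Suc m)
  have "x *\<^sub>R K + Y + K = (x + 1) *\<^sub>R K + Y"
    using body_add_scale[OF Suc.prems zero_le_one, of K] by (simp add: body_scale_one ac_simps)
  with Suc show ?case
    by simp
qed

lemma body_vol_scale:
  fixes K :: "'a::euclidean_space convex_body"
  assumes "0 \<le> t"
  shows "body_vol (t *\<^sub>R K) = t ^ DIM('a) * body_vol K"
  unfolding body_vol_def body_set_scaleR
  using measure_lebesgue_affine[of t 0 "body_set K"] assms by simp

lemma polarized_vol_replicate: "polarized_vol (replicate CARD('n) K) = body_vol (K :: (real^'n) convex_body)"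
proof -
  have "idiff body_vol (replicate CARD('n) K) (0 *\<^sub>R K + 0) =
      idiff (\<lambda>t. body_vol K * t ^ CARD('n)) (replicate CARD('n) 1) 0"
    by (rule idiff_replicate_ray) (simp_all add: body_vol_scale)
  then show ?thesis
    unfolding polarized_vol_def idiff_cmult idiff_power by (simp add: body_scale_zero)
qed

lemma body_scale_zero_right: "t *\<^sub>R 0 = (0 :: 'a::euclidean_space convex_body)"
  by (rule body_eqI) (simp add: body_set_scaleR body_set_zero)

lemma polarized_vol_sum:
  fixes Ls :: "(real^'n) convex_body list"
  assumes len: "Suc (length Ls) = CARD('n)" and c: "\<And>i. i \<in> A \<Longrightarrow> 0 \<le> c i" and "finite A"
  shows "polarized_vol ((\<Sum>i\<in>A. c i *\<^sub>R K i) # Ls) = (\<Sum>i\<in>A. c i * polarized_vol (K i # Ls))"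
  using \<open>finite A\<close> c
proof (induction A rule: finite_induct)
  case empty
  show ?case
    using polarized_vol_scale[OF len, of 0 0] by (simp add: body_scale_zero_right)
next
  case (insert i A)
  then show ?case
    by (simp add: polarized_vol_add[OF len] polarized_vol_scale[OF len])
qed

lemma polarized_vol_expand:
  fixes Ls :: "(real^'n) convex_body list"
  assumes "m + length Ls = CARD('n)" and c: "\<And>i. i \<in> A \<Longrightarrow> 0 \<le> c i" and A: "finite A"
  shows "polarized_vol (replicate m (\<Sum>i\<in>A. c i *\<^sub>R K i) @ Ls) =
    (\<Sum>is\<in>{is. set is \<subseteq> A \<and> length is = m}. (\<Prod>j<m. c (is ! j)) * polarized_vol (map K is @ Ls))"
  using assms(1)
proof (induction m arbitrary: Ls)
  case 0
  have "{is. set is \<subseteq> A \<and> length is = 0} = {[]}"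
    by auto
  then show ?case
    by simp
next
  case (Suc m)
  let ?S = "\<Sum>i\<in>A. c i *\<^sub>R K i" and ?L = "{is. set is \<subseteq> A \<and> length is = m}"
  have "polarized_vol (replicate (Suc m) ?S @ Ls) = polarized_vol (replicate m ?S @ (?S # Ls))"
    by (rule polarized_vol_mset) simp
  also have "\<dots> = (\<Sum>is\<in>?L. (\<Prod>j<m. c (is ! j)) * polarized_vol (map K is @ ?S # Ls))"
    using Suc.prems by (intro Suc.IH) simp
  also have "\<dots> = (\<Sum>is\<in>?L. \<Sum>i\<in>A. (\<Prod>j<Suc m. c ((i # is) ! j)) * polarized_vol (map K (i # is) @ Ls))"
  proof (intro sum.cong refl)
    fix "is"
    assume mem: "is \<in> ?L"
    have "polarized_vol (map K is @ ?S # Ls) = polarized_vol (?S # map K is @ Ls)"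
      by (rule polarized_vol_mset) simp
    also have "\<dots> = (\<Sum>i\<in>A. c i * polarized_vol (K i # map K is @ Ls))"
      using mem Suc.prems c A by (intro polarized_vol_sum) auto
    finally show "(\<Prod>j<m. c (is ! j)) * polarized_vol (map K is @ ?S # Ls) =
        (\<Sum>i\<in>A. (\<Prod>j<Suc m. c ((i # is) ! j)) * polarized_vol (map K (i # is) @ Ls))"
      by (simp add: prod.lessThan_Suc_shift sum_distrib_left ac_simps del: prod.lessThan_Suc)
  qed
  also have "\<dots> = (\<Sum>(is, i)\<in>?L \<times> A. (\<Prod>j<Suc m. c ((i # is) ! j)) * polarized_vol (map K (i # is) @ Ls))"
    by (rule sum.cartesian_product)
  also have "\<dots> = (\<Sum>is\<in>{is. set is \<subseteq> A \<and> length is = Suc m}.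
      (\<Prod>j<Suc m. c (is ! j)) * polarized_vol (map K is @ Ls))"
    unfolding lists_length_Suc_eq
    by (subst sum.reindex) (auto simp: inj_on_def intro!: sum.cong)
  finally show ?case .
qed

section \<open>Existence and uniqueness of mixed volumes\<close>

lemma is_mixed_volume_polarized_vol: "is_mixed_volume (polarized_vol :: (real^'n) convex_body list \<Rightarrow> real)"
  unfolding is_mixed_volume_def
proof (intro conjI allI impI)
  fix Ks Ls :: "(real^'n) convex_body list"
  assume "length Ks = DIM(real^'n) \<and> mset Ks = mset Ls"
  then show "polarized_vol Ks = polarized_vol Ls"
    by (auto intro: polarized_vol_mset)
next
  fix Ks :: "(real^'n) convex_body list" and c :: "nat \<Rightarrow> real"
  assume "length Ks = DIM(real^'n) \<and> (\<forall>i<DIM(real^'n). 0 \<le> c i)"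
  then have c: "\<And>i. i \<in> {..<CARD('n)} \<Longrightarrow> 0 \<le> c i"
    by simp
  show "measure lebesgue (body_set (\<Sum>i<DIM(real^'n). c i *\<^sub>R Ks ! i)) =
      (\<Sum>is | length is = DIM(real^'n) \<and> set is \<subseteq> {..<DIM(real^'n)}.
        (\<Prod>j<DIM(real^'n). c (is ! j)) * polarized_vol (map ((!) Ks) is))"
    using polarized_vol_expand[of "CARD('n)" "[]" "{..<CARD('n)}" c "(!) Ks", OF _ c]
    by (simp add: polarized_vol_replicate[unfolded body_vol_def] conj_commute)
qed

text \<open>Inclusion and exclusion: the signs of the sets between \<open>B\<close> and \<open>A\<close> cancel unless \<open>A\<close> is the only such set.\<close>

lemma sum_neg_one_power_supersets:
  assumes "finite A" "B \<subseteq> A"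
  shows "(\<Sum>S\<in>Pow A. (-1) ^ card S * (if B \<subseteq> S then 1 else 0)) =
    (if B = A then (-1) ^ card A else (0 :: real))"
proof -
  have "(\<Sum>S\<in>Pow A. (-1) ^ card S * (if B \<subseteq> S then 1 else (0::real))) =
      (\<Sum>S | S \<in> Pow A \<and> B \<subseteq> S. (-1) ^ card S)"
    using assms(1) by (intro sum.mono_neutral_cong_right) auto
  also have "\<dots> = (if B = A then (-1) ^ card A else 0)"
  proof (cases "B = A")
    case True
    then have "{S. S \<in> Pow A \<and> B \<subseteq> S} = {A}"
      by auto
    with True show ?thesis
      by simp
  next
    case False
    then have "B \<subset> A"
      using assms(2) by auto
    then have "card {S. S \<in> {S. S \<in> Pow A \<and> B \<subseteq> S} \<and> even (card S)} =
        card {S. S \<in> {S. S \<in> Pow A \<and> B \<subseteq> S} \<and> odd (card S)}"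
      using card_subsupersets_even_odd[OF assms(1), of B] by (simp add: conj_assoc)
    then show ?thesis
      using False assms(1) by (subst sum_alternating_cancels) auto
  qed
  finally show ?thesis .
qed

lemma is_mixed_volume_expand:
  fixes V :: "'a::euclidean_space convex_body list \<Rightarrow> real"
  assumes "is_mixed_volume V" "length Ks = DIM('a)" "\<And>i. i < DIM('a) \<Longrightarrow> 0 \<le> c i"
  shows "measure lebesgue (body_set (\<Sum>i<DIM('a). c i *\<^sub>R Ks ! i)) =
    (\<Sum>is | length is = DIM('a) \<and> set is \<subseteq> {..<DIM('a)}.
      (\<Prod>j<DIM('a). c (is ! j)) * V (map ((!) Ks) is))"
  using assms unfolding is_mixed_volume_def by blast

lemma is_mixed_volume_mset:
  fixes V :: "'a::euclidean_space convex_body list \<Rightarrow> real"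
  assumes "is_mixed_volume V" "length Ks = DIM('a)" "mset Ks = mset Ls"
  shows "V Ks = V Ls"
  using assms unfolding is_mixed_volume_def by blast

text \<open>Evaluate the expansion of the volume at the indicator vectors of all \<open>S \<subseteq> {..<n}\<close> and take the alternating
  sum over \<open>S\<close>. Only multi-indices that use every index survive; these are permutations, and by symmetry
  each of them contributes the same value.\<close>

lemma is_mixed_volume_unique:
  fixes V W :: "'a::euclidean_space convex_body list \<Rightarrow> real"
  assumes V: "is_mixed_volume V" and W: "is_mixed_volume W" and len: "length Ks = DIM('a)"
  shows "V Ks = W Ks"
proof -
  define n where "n = DIM('a)"
  let ?L = "{is. length is = n \<and> set is \<subseteq> {..<n}}" and ?P = "{is. length is = n \<and> set is = {..<n}}"
  have fin: "finite ?L"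
    using finite_lists_length_eq[of "{..<n}" n] by (simp add: conj_commute)
  have polarization: "(\<Sum>S\<in>Pow {..<n}. (-1) ^ card S *
      measure lebesgue (body_set (\<Sum>i<n. (if i \<in> S then 1 else 0) *\<^sub>R Ks ! i))) =
      (-1) ^ n * (real (card ?P) * U Ks)" if U: "is_mixed_volume U" for U
  proof -
    have vol: "measure lebesgue (body_set (\<Sum>i<n. (if i \<in> S then 1 else 0) *\<^sub>R Ks ! i)) =
        (\<Sum>is\<in>?L. (if set is \<subseteq> S then 1 else 0) * U (map ((!) Ks) is))" for S
    proof -
      have "measure lebesgue (body_set (\<Sum>i<n. (if i \<in> S then 1 else 0) *\<^sub>R Ks ! i)) =
          (\<Sum>is\<in>?L. (\<Prod>j<n. if is ! j \<in> S then 1 else 0) * U (map ((!) Ks) is))"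
        using is_mixed_volume_expand[OF U len, of "\<lambda>i. if i \<in> S then 1 else 0"]
        unfolding n_def by simp
      also have "\<dots> = (\<Sum>is\<in>?L. (if set is \<subseteq> S then 1 else 0) * U (map ((!) Ks) is))"
      proof (intro sum.cong refl)
        fix "is"
        assume mem: "is \<in> ?L"
        have "(\<Prod>j<n. if is ! j \<in> S then 1 else 0) = (if set is \<subseteq> S then 1 else (0::real))"
        proof (cases "set is \<subseteq> S")
          case True
          then have "is ! j \<in> S" if "j < n" for j
            using mem that nth_mem[of j "is"] by blast
          with True show ?thesis
            by simp
        next
          case False
          then obtain j where "j < n" "is ! j \<notin> S"
            using mem by (auto simp: subset_iff in_set_conv_nth)
          with False show ?thesis
            by (auto intro!: prod_zero)
        qed
        then show "(\<Prod>j<n. if is ! j \<in> S then 1 else 0) * U (map ((!) Ks) is) =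
            (if set is \<subseteq> S then 1 else 0) * U (map ((!) Ks) is)"
          by simp
      qed
      finally show ?thesis .
    qed
    have "(\<Sum>S\<in>Pow {..<n}. (-1) ^ card S *
        measure lebesgue (body_set (\<Sum>i<n. (if i \<in> S then 1 else 0) *\<^sub>R Ks ! i))) =
        (\<Sum>is\<in>?L. (\<Sum>S\<in>Pow {..<n}. (-1) ^ card S * (if set is \<subseteq> S then 1 else 0)) * U (map ((!) Ks) is))"
      unfolding vol sum_distrib_left sum_distrib_right mult.assoc by (rule sum.swap)
    also have "\<dots> = (\<Sum>is\<in>?L. (if set is = {..<n} then (-1) ^ n * U (map ((!) Ks) is) else 0))"
      by (intro sum.cong refl) (simp add: sum_neg_one_power_supersets)
    also have "\<dots> = (\<Sum>is | is \<in> ?L \<and> set is = {..<n}. (-1) ^ n * U (map ((!) Ks) is))"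
      using fin by (rule sum.inter_filter[symmetric])
    also have "{is. is \<in> ?L \<and> set is = {..<n}} = ?P"
      by auto
    also have "(\<Sum>is\<in>?P. (-1) ^ n * U (map ((!) Ks) is)) = (\<Sum>is\<in>?P. (-1) ^ n * U Ks)"
    proof (intro sum.cong refl)
      fix "is"
      assume mem: "is \<in> ?P"
      then have "distinct is"
        by (simp add: card_distinct)
      then have "mset is = mset [0..<n]"
        using mem by (intro set_eq_iff_mset_eq_distinct[THEN iffD1]) (auto simp: atLeast0LessThan)
      then have "mset (map ((!) Ks) is) = mset (map ((!) Ks) [0..<n])"
        by (metis mset_map)
      also have "map ((!) Ks) [0..<n] = Ks"
        using map_nth[of Ks] unfolding len n_def .
      finally show "(-1) ^ n * U (map ((!) Ks) is) = (-1) ^ n * U Ks"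
        using is_mixed_volume_mset[OF U, of "map ((!) Ks) is" Ks] mem n_def by simp
    qed
    finally show ?thesis
      by simp
  qed
  have "[0..<n] \<in> ?P"
    by auto
  moreover have "finite ?P"
    by (rule finite_subset[OF _ fin]) auto
  ultimately have "card ?P \<noteq> 0"
    using card_0_eq[of ?P] by blast
  then show ?thesis
    using polarization[OF V] polarization[OF W] by simp
qed

theorem mixed_volume_eq_polarized_vol:
  fixes Ks :: "(real^'n) convex_body list"
  assumes "length Ks = CARD('n)"
  shows "mixed_volume Ks = polarized_vol Ks"
  unfolding mixed_volume_def
proof (rule the_equality)
  show "\<exists>V. is_mixed_volume V \<and> polarized_vol Ks = V Ks"
    using is_mixed_volume_polarized_vol by blast
next
  fix v
  assume "\<exists>V. is_mixed_volume V \<and> v = V Ks"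
  then obtain V where "is_mixed_volume V" "v = V Ks"
    by blast
  then show "v = polarized_vol Ks"
    using is_mixed_volume_unique[OF _ is_mixed_volume_polarized_vol] assms by simp
qed

section \<open>Lipschitz continuity in the Hausdorff metric\<close>

lemma body_dist_le_iff:
  "dist K L \<le> e \<longleftrightarrow> (\<forall>x\<in>body_set K. \<exists>y\<in>body_set L. dist x y \<le> e) \<and>
     (\<forall>y\<in>body_set L. \<exists>x\<in>body_set K. dist y x \<le> e)"
proof -
  have "infdist x (body_set M) \<le> e \<longleftrightarrow> (\<exists>y\<in>body_set M. dist x y \<le> e)"
    for x and M :: "'a::euclidean_space convex_body"
    using infdist_attains_inf[OF compact_imp_closed[OF body_set_compact] body_set_nonempty, of M x]
      infdist_le2 by metis
  then show ?thesis
    unfolding dist_convex_body_def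
    by (simp add: hausdorff_dist_le_iff body_set_nonempty body_set_compact)
qed

lemma body_dist_witness:
  assumes "x \<in> body_set K"
  obtains y where "y \<in> body_set L" "dist x y \<le> dist K L"
  using assms body_dist_le_iff[of K L "dist K L"] by auto

lemma body_dist_add: "dist (K + M) (L + N) \<le> dist K L + dist M (N :: 'a::euclidean_space convex_body)"
proof -
  have *: "\<exists>w\<in>body_set (L + N). dist z w \<le> dist K L + dist M N" if z: "z \<in> body_set (K + M)"
    for z and K L M N :: "'a convex_body"
  proof -
    obtain x y where xy: "z = x + y" "x \<in> body_set K" "y \<in> body_set M"
      using z unfolding body_set_plus by blast
    obtain x' where x': "x' \<in> body_set L" "dist x x' \<le> dist K L"
      using body_dist_witness[OF xy(2)] .
    obtain y' where y': "y' \<in> body_set N" "dist y y' \<le> dist M N"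
      using body_dist_witness[OF xy(3)] .
    show ?thesis
    proof (intro bexI)
      show "dist z (x' + y') \<le> dist K L + dist M N"
        using dist_triangle_add[of x y x' y'] x'(2) y'(2) by (simp add: xy(1))
      show "x' + y' \<in> body_set (L + N)"
        unfolding body_set_plus using x' y' by blast
    qed
  qed
  from *[of _ K M L N] *[of _ L N K M] show ?thesis
    unfolding body_dist_le_iff by (simp add: dist_commute)
qed

lemma body_dist_le_diameter:
  assumes "body_set K \<subseteq> cball 0 R" "body_set L \<subseteq> cball (0::'a::euclidean_space) R"
  shows "dist K L \<le> 2 * R"
proof -
  have "dist x y \<le> 2 * R" if "x \<in> cball 0 R" "y \<in> cball 0 R" for x y :: 'a
    using that norm_triangle_ineq4[of x y] by (simp add: dist_norm)
  then show ?thesis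
    unfolding body_dist_le_iff using assms body_set_nonempty[of K] body_set_nonempty[of L] by blast
qed

definition unit_body :: "'a::euclidean_space convex_body" where
  "unit_body = Body (cball 0 1)"

lemma body_set_unit_body: "body_set unit_body = cball 0 1"
  unfolding unit_body_def by (rule Body_inverse) simp

lemma body_subset_neighbourhood:
  "body_set K \<subseteq> body_set (L + dist K L *\<^sub>R (unit_body :: 'a::euclidean_space convex_body))"
proof
  fix x assume "x \<in> body_set K"
  then obtain y where y: "y \<in> body_set L" "dist x y \<le> dist K L"
    by (rule body_dist_witness)
  have "x - y \<in> body_set (dist K L *\<^sub>R unit_body)"
  proof (cases "dist K L = 0")
    case True
    then show ?thesis
      using y(2) by (simp add: body_scale_zero body_set_zero)
  next
    case False
    have "x - y = dist K L *\<^sub>R ((1 / dist K L) *\<^sub>R (x - y))"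
      using False by simp
    moreover have "(1 / dist K L) *\<^sub>R (x - y) \<in> cball 0 1"
      using False y(2) by (simp add: dist_norm)
    ultimately show ?thesis
      unfolding body_set_scaleR body_set_unit_body by (rule image_eqI)
  qed
  then show "x \<in> body_set (L + dist K L *\<^sub>R unit_body)"
    using y(1) unfolding body_set_plus by force
qed

lemma polarized_vol_bound:
  fixes Ks :: "(real^'n) convex_body list"
  assumes "\<forall>K\<in>set Ks. body_set K \<subseteq> cball 0 R" "0 \<le> R" "length Ks = CARD('n)"
  shows "\<bar>polarized_vol Ks\<bar> \<le> 2 ^ CARD('n) * measure lebesgue (cball (0::real^'n) (real CARD('n) * R)) / fact CARD('n)"
  using idiff_body_vol_bound[OF assms(1) _ assms(2), of 0 0] assms(3)
  unfolding polarized_vol_def by (simp add: body_set_zero divide_right_mono)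

text \<open>If \<open>K\<close> and \<open>L\<close> have distance \<open>d\<close>, then \<open>K\<close> is contained in \<open>L + d B\<close> with the unit ball \<open>B\<close>. Replacing
  the arguments \<open>L\<close> of the polarized volume one at a time by \<open>L + d B\<close> changes it, by multilinearity, by
  \<open>d\<close> times a polarized volume of bounded bodies in each of the \<open>n\<close> steps.\<close>

lemma body_vol_lipschitz:
  fixes R :: real
  assumes "0 \<le> R"
  shows "\<exists>C\<ge>0. \<forall>K L :: (real^'n) convex_body. body_set K \<subseteq> cball 0 R \<longrightarrow> body_set L \<subseteq> cball 0 R \<longrightarrow>
    \<bar>body_vol K - body_vol L\<bar> \<le> C * dist K L"
proof -
  define B where "B = 2 ^ CARD('n) * measure lebesgue (cball (0::real^'n) (real CARD('n) * (3 * R + 1))) / fact CARD('n)"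
  have "0 \<le> B"
    by (simp add: B_def)
  have growth: "body_vol (L + d *\<^sub>R unit_body) - body_vol L \<le> real CARD('n) * B * d"
    if L: "body_set L \<subseteq> cball 0 R" and d: "0 \<le> d" "d \<le> 2 * R" for L :: "(real^'n) convex_body" and d
  proof -
    define M where "M = L + d *\<^sub>R unit_body"
    have "body_set M \<subseteq> cball 0 (R + d * 1)"
      unfolding M_def using L d
      by (intro body_set_plus_subset_cball body_set_scale_subset_cball) (simp_all add: body_set_unit_body)
    also have "\<dots> \<subseteq> cball 0 (3 * R + 1)"
      using d by (intro subset_cball) simp
    finally have M: "body_set M \<subseteq> cball 0 (3 * R + 1)" .
    have L': "body_set L \<subseteq> cball 0 (3 * R + 1)"
      using L assms subset_cball[of R "3 * R + 1" "0::real^'n"] by simp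
    have U: "body_set (unit_body :: (real^'n) convex_body) \<subseteq> cball 0 (3 * R + 1)"
      unfolding body_set_unit_body using assms by (intro subset_cball) simp
    \<comment> \<open>interpolates between the volumes of L and of M\<close>
    define f where "f j = polarized_vol (replicate j M @ replicate (CARD('n) - j) L)" for j
    have step: "f (Suc j) - f j \<le> B * d" if j: "j < CARD('n)" for j
    proof -
      define Ks where "Ks = replicate j M @ replicate (CARD('n) - Suc j) L"
      have len: "Suc (length Ks) = CARD('n)"
        using j by (simp add: Ks_def)
      have split: "CARD('n) - j = Suc (CARD('n) - Suc j)"
        using j by simp
      have "f (Suc j) = polarized_vol (M # Ks)"
        by (simp add: f_def Ks_def)
      moreover have "f j = polarized_vol (L # Ks)"
        unfolding f_def Ks_def split by (rule polarized_vol_mset) simp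
      moreover have "polarized_vol (M # Ks) = polarized_vol (L # Ks) + d * polarized_vol (unit_body # Ks)"
        unfolding M_def polarized_vol_add[OF len] polarized_vol_scale[OF len d(1)] by simp
      moreover have "\<bar>polarized_vol (unit_body # Ks)\<bar> \<le> B"
        unfolding B_def using M L' U assms len by (intro polarized_vol_bound) (auto simp: Ks_def)
      then have "d * polarized_vol (unit_body # Ks) \<le> d * B"
        using d by (intro mult_left_mono) auto
      ultimately show ?thesis
        by (simp add: mult.commute)
    qed
    have "body_vol M - body_vol L = f CARD('n) - f 0"
      by (simp add: f_def polarized_vol_replicate)
    also have "\<dots> = (\<Sum>j<CARD('n). f (Suc j) - f j)"
      by (rule sum_lessThan_telescope[symmetric])
    also have "\<dots> \<le> (\<Sum>j<CARD('n). B * d)"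
      using step by (intro sum_mono) simp
    finally show ?thesis
      by (simp add: M_def)
  qed
  have one: "body_vol K - body_vol L \<le> real CARD('n) * B * dist K L"
    if "body_set K \<subseteq> cball 0 R" "body_set L \<subseteq> cball 0 R" for K L :: "(real^'n) convex_body"
  proof -
    have "body_vol K \<le> body_vol (L + dist K L *\<^sub>R unit_body)"
      by (intro body_vol_mono body_subset_neighbourhood)
    with growth[OF that(2) zero_le_dist body_dist_le_diameter[OF that]] show ?thesis
      by linarith
  qed
  show ?thesis
  proof (intro exI[of _ "real CARD('n) * B"] conjI allI impI)
    fix K L :: "(real^'n) convex_body"
    assume "body_set K \<subseteq> cball 0 R" "body_set L \<subseteq> cball 0 R"
    then show "\<bar>body_vol K - body_vol L\<bar> \<le> real CARD('n) * B * dist K L"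
      using one[of K L] one[of L K] by (simp add: dist_commute abs_le_iff)
  qed (simp add: \<open>0 \<le> B\<close>)
qed

lemma idiff_body_vol_lipschitz:
  fixes Ks Ls :: "'a::euclidean_space convex_body list"
  assumes C: "0 \<le> C" "\<And>K L :: 'a convex_body. body_set K \<subseteq> cball 0 S \<Longrightarrow> body_set L \<subseteq> cball 0 S \<Longrightarrow>
      \<bar>body_vol K - body_vol L\<bar> \<le> C * dist K L"
    and "length Ks = length Ls" "\<forall>K\<in>set Ks \<union> set Ls. body_set K \<subseteq> cball 0 R" "0 \<le> R"
    and "body_set X \<subseteq> cball 0 r" "body_set Y \<subseteq> cball 0 r" "r + real (length Ks) * R \<le> S"
  shows "\<bar>idiff body_vol Ks X - idiff body_vol Ls Y\<bar> \<le>
    2 ^ length Ks * (C * (dist X Y + sum_list (map2 dist Ks Ls)))"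
  using assms(3-)
proof (induction Ks Ls arbitrary: X Y r rule: list_induct2)
  case Nil
  then have "body_set X \<subseteq> cball 0 S" "body_set Y \<subseteq> cball 0 S"
    by (auto simp: subset_iff)
  then show ?case
    using C(2) by simp
next
  case (Cons K Ks L Ls)
  define s where "s = sum_list (map2 dist Ks Ls)"
  let ?p = "2 ^ length Ks :: real"
  have "\<bar>idiff body_vol Ks (X + K) - idiff body_vol Ls (Y + L)\<bar> \<le> ?p * (C * (dist (X + K) (Y + L) + s))"
    unfolding s_def using Cons.prems
    by (intro Cons.IH[where r = "r + R"] body_set_plus_subset_cball) (auto simp: algebra_simps)
  also have "\<dots> \<le> ?p * (C * (dist X Y + dist K L + s))"
    using C(1) body_dist_add[of X K Y L] by (intro mult_left_mono) auto
  finally have 1: "\<bar>idiff body_vol Ks (X + K) - idiff body_vol Ls (Y + L)\<bar> \<le> ?p * (C * (dist X Y + dist K L + s))" .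
  have "r + real (length Ks) * R \<le> S"
    using Cons.prems by (simp add: algebra_simps)
  then have "\<bar>idiff body_vol Ks X - idiff body_vol Ls Y\<bar> \<le> ?p * (C * (dist X Y + s))"
    unfolding s_def using Cons.prems by (intro Cons.IH[where r = r]) auto
  also have "\<dots> \<le> ?p * (C * (dist X Y + dist K L + s))"
    using C(1) by (intro mult_left_mono) auto
  finally have 2: "\<bar>idiff body_vol Ks X - idiff body_vol Ls Y\<bar> \<le> ?p * (C * (dist X Y + dist K L + s))" .
  have "\<bar>idiff body_vol (K # Ks) X - idiff body_vol (L # Ls) Y\<bar> \<le> 2 * (?p * (C * (dist X Y + dist K L + s)))"
    using 1 2 unfolding idiff.simps by linarith
  then show ?case
    by (simp add: s_def add.assoc mult.assoc)
qed

lemma polarized_vol_lipschitz: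
  assumes "0 \<le> R"
  shows "\<exists>C\<ge>0. \<forall>Ks Ls :: (real^'n) convex_body list. length Ks = CARD('n) \<longrightarrow> length Ls = CARD('n) \<longrightarrow>
    (\<forall>K\<in>set Ks \<union> set Ls. body_set K \<subseteq> cball 0 R) \<longrightarrow>
    \<bar>polarized_vol Ks - polarized_vol Ls\<bar> \<le> C * sum_list (map2 dist Ks Ls)"
proof -
  obtain C where C: "C \<ge> 0" "\<And>K L :: (real^'n) convex_body. body_set K \<subseteq> cball 0 (real CARD('n) * R) \<Longrightarrow>
      body_set L \<subseteq> cball 0 (real CARD('n) * R) \<Longrightarrow> \<bar>body_vol K - body_vol L\<bar> \<le> C * dist K L"
    using body_vol_lipschitz[of "real CARD('n) * R", where 'n = 'n] assms by auto
  show ?thesis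
  proof (intro exI[of _ "2 ^ CARD('n) * C / fact CARD('n)"] conjI allI impI)
    fix Ks Ls :: "(real^'n) convex_body list"
    assume len: "length Ks = CARD('n)" "length Ls = CARD('n)"
      and sub: "\<forall>K\<in>set Ks \<union> set Ls. body_set K \<subseteq> cball 0 R"
    have "\<bar>idiff body_vol Ks 0 - idiff body_vol Ls 0\<bar> \<le>
        2 ^ length Ks * (C * (dist (0 :: (real^'n) convex_body) 0 + sum_list (map2 dist Ks Ls)))"
    proof (rule idiff_body_vol_lipschitz[OF C])
      show "0 + real (length Ks) * R \<le> real CARD('n) * R"
        by (simp add: len)
    qed (use len assms sub in \<open>simp_all add: body_set_zero\<close>)
    then show "\<bar>polarized_vol Ks - polarized_vol Ls\<bar> \<le> 2 ^ CARD('n) * C / fact CARD('n) * sum_list (map2 dist Ks Ls)"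
      unfolding polarized_vol_def diff_divide_distrib[symmetric] abs_divide using len
      by (simp add: divide_right_mono mult.assoc)
  qed (simp add: C)
qed

text \<open>Lipschitz on bounded sets of bodies. It implies continuity, and it is the property that distinguishes
  the span of the mixed volumes within the continuous valuations.\<close>

definition locally_lipschitz :: "('a::euclidean_space convex_body \<Rightarrow> real) \<Rightarrow> bool" where
  "locally_lipschitz \<mu> \<longleftrightarrow> (\<forall>R\<ge>0. \<exists>C. \<forall>K L. body_set K \<subseteq> cball 0 R \<longrightarrow> body_set L \<subseteq> cball 0 R \<longrightarrow>
     \<bar>\<mu> K - \<mu> L\<bar> \<le> C * dist K L)"

lemma neighbour_subset_cball:
  assumes "body_set K \<subseteq> cball 0 r" "dist K L < 1"
  shows "body_set L \<subseteq> cball (0::'a::euclidean_space) (r + 1)"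
proof
  fix y assume "y \<in> body_set L"
  then obtain x where "x \<in> body_set K" "dist y x \<le> dist L K"
    by (rule body_dist_witness)
  then have "norm x \<le> r" "norm (y - x) < 1"
    using assms by (auto simp: dist_norm dist_commute)
  then show "y \<in> cball 0 (r + 1)"
    using norm_triangle_ineq[of x "y - x"] by simp
qed

lemma locally_lipschitz_imp_continuous:
  assumes "locally_lipschitz \<mu>"
  shows "continuous_on UNIV \<mu>"
  unfolding continuous_on_iff
proof (intro ballI allI impI)
  fix K :: "'a convex_body" and e :: real
  assume "e > 0"
  obtain r where r: "r > 0" "body_set K \<subseteq> cball 0 r"
    using body_subset_cball by blast
  then obtain C where C: "\<And>K L. body_set K \<subseteq> cball 0 (r + 1) \<Longrightarrow> body_set L \<subseteq> cball 0 (r + 1) \<Longrightarrow>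
      \<bar>\<mu> K - \<mu> L\<bar> \<le> C * dist K L"
    using assms unfolding locally_lipschitz_def by (metis add_nonneg_nonneg less_eq_real_def zero_le_one)
  show "\<exists>d>0. \<forall>L\<in>UNIV. dist L K < d \<longrightarrow> dist (\<mu> L) (\<mu> K) < e"
  proof (intro exI[of _ "min 1 (e / (\<bar>C\<bar> + 1))"] conjI ballI impI)
    show "0 < min 1 (e / (\<bar>C\<bar> + 1))"
      using \<open>e > 0\<close> by simp
    fix L assume L: "dist L K < min 1 (e / (\<bar>C\<bar> + 1))"
    have "body_set K \<subseteq> cball 0 (r + 1)"
      using r(2) subset_cball[of r "r + 1" "0::'a"] by simp
    moreover have "body_set L \<subseteq> cball 0 (r + 1)"
      using L by (intro neighbour_subset_cball[OF r(2)]) (simp add: dist_commute)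
    ultimately have "\<bar>\<mu> L - \<mu> K\<bar> \<le> C * dist L K"
      by (intro C)
    also have "\<dots> \<le> (\<bar>C\<bar> + 1) * dist L K"
      by (intro mult_right_mono) auto
    also have "\<dots> < e"
      using L by (simp add: field_simps)
    finally show "dist (\<mu> L) (\<mu> K) < e"
      by (simp add: dist_real_def)
  qed
qed

lemma subspace_locally_lipschitz: "subspace {\<mu>. locally_lipschitz \<mu>}"
proof (rule subspaceI; clarsimp simp only: mem_Collect_eq)
  show "locally_lipschitz 0"
    unfolding locally_lipschitz_def by (auto intro!: exI[of _ 0])
next
  fix \<mu> \<nu> :: "'a convex_body \<Rightarrow> real"
  assume \<mu>: "locally_lipschitz \<mu>" and \<nu>: "locally_lipschitz \<nu>"
  show "locally_lipschitz (\<mu> + \<nu>)"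
    unfolding locally_lipschitz_def
  proof (intro allI impI)
    fix R :: real
    assume "0 \<le> R"
    with \<mu> \<nu> obtain C D where CD:
      "\<forall>K L. body_set K \<subseteq> cball 0 R \<longrightarrow> body_set L \<subseteq> cball 0 R \<longrightarrow> \<bar>\<mu> K - \<mu> L\<bar> \<le> C * dist K L"
      "\<forall>K L. body_set K \<subseteq> cball 0 R \<longrightarrow> body_set L \<subseteq> cball 0 R \<longrightarrow> \<bar>\<nu> K - \<nu> L\<bar> \<le> D * dist K L"
      unfolding locally_lipschitz_def by blast
    show "\<exists>C. \<forall>K L. body_set K \<subseteq> cball 0 R \<longrightarrow> body_set L \<subseteq> cball 0 R \<longrightarrow>
        \<bar>(\<mu> + \<nu>) K - (\<mu> + \<nu>) L\<bar> \<le> C * dist K L"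
    proof (intro exI[of _ "C + D"] allI impI)
      fix K L :: "'a convex_body"
      assume "body_set K \<subseteq> cball 0 R" "body_set L \<subseteq> cball 0 R"
      then have "\<bar>\<mu> K - \<mu> L\<bar> \<le> C * dist K L" "\<bar>\<nu> K - \<nu> L\<bar> \<le> D * dist K L"
        using CD by blast+
      then show "\<bar>(\<mu> + \<nu>) K - (\<mu> + \<nu>) L\<bar> \<le> (C + D) * dist K L"
        unfolding plus_fun_def distrib_right by linarith
    qed
  qed
next
  fix c and \<mu> :: "'a convex_body \<Rightarrow> real"
  assume \<mu>: "locally_lipschitz \<mu>"
  show "locally_lipschitz (c *\<^sub>R \<mu>)"
    unfolding locally_lipschitz_def
  proof (intro allI impI)
    fix R :: real
    assume "0 \<le> R"
    with \<mu> obtain C where C: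
      "\<forall>K L. body_set K \<subseteq> cball 0 R \<longrightarrow> body_set L \<subseteq> cball 0 R \<longrightarrow> \<bar>\<mu> K - \<mu> L\<bar> \<le> C * dist K L"
      unfolding locally_lipschitz_def by blast
    show "\<exists>C. \<forall>K L. body_set K \<subseteq> cball 0 R \<longrightarrow> body_set L \<subseteq> cball 0 R \<longrightarrow>
        \<bar>(c *\<^sub>R \<mu>) K - (c *\<^sub>R \<mu>) L\<bar> \<le> C * dist K L"
    proof (intro exI[of _ "\<bar>c\<bar> * C"] allI impI)
      fix K L :: "'a convex_body"
      assume "body_set K \<subseteq> cball 0 R" "body_set L \<subseteq> cball 0 R"
      then have "\<bar>c\<bar> * \<bar>\<mu> K - \<mu> L\<bar> \<le> \<bar>c\<bar> * (C * dist K L)"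
        using C by (intro mult_left_mono) auto
      then show "\<bar>(c *\<^sub>R \<mu>) K - (c *\<^sub>R \<mu>) L\<bar> \<le> \<bar>c\<bar> * C * dist K L"
        by (simp add: scaleR_fun_def abs_mult[symmetric] right_diff_distrib mult.assoc)
    qed
  qed
qed

lemma locally_lipschitz_polarized_vol:
  fixes Ls :: "(real^'n) convex_body list"
  assumes "k + length Ls = CARD('n)"
  shows "locally_lipschitz (\<lambda>K. polarized_vol (replicate k K @ Ls))"
  unfolding locally_lipschitz_def
proof (intro allI impI)
  fix R :: real
  assume "0 \<le> R"
  obtain S where S: "S > 0" "\<forall>L\<in>set Ls. body_set L \<subseteq> cball 0 S"
    using bodies_subset_cball[of "set Ls"] by auto
  obtain C where C: "\<forall>Ks Ms :: (real^'n) convex_body list. length Ks = CARD('n) \<longrightarrow> length Ms = CARD('n) \<longrightarrow>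
      (\<forall>K\<in>set Ks \<union> set Ms. body_set K \<subseteq> cball 0 (max R S)) \<longrightarrow>
      \<bar>polarized_vol Ks - polarized_vol Ms\<bar> \<le> C * sum_list (map2 dist Ks Ms)"
    using polarized_vol_lipschitz[of "max R S", where 'n = 'n] \<open>0 \<le> R\<close> le_max_iff_disj by blast
  have sub: "cball (0::real^'n) R \<subseteq> cball 0 (max R S)" "cball (0::real^'n) S \<subseteq> cball 0 (max R S)"
    by (intro subset_cball; simp)+
  have dist: "sum_list (map2 dist (replicate k K @ Ls) (replicate k L @ Ls)) = real k * dist K L"
    for K L :: "(real^'n) convex_body"
  proof -
    have "sum_list (map2 dist (replicate k K) (replicate k L)) = real k * dist K L"
      by (simp add: zip_replicate sum_list_replicate)
    moreover have "sum_list (map2 dist Ls Ls) = 0"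
      by (induction Ls) simp_all
    ultimately show ?thesis
      by simp
  qed
  show "\<exists>C. \<forall>K L. body_set K \<subseteq> cball 0 R \<longrightarrow> body_set L \<subseteq> cball 0 R \<longrightarrow>
      \<bar>polarized_vol (replicate k K @ Ls) - polarized_vol (replicate k L @ Ls)\<bar> \<le> C * dist K L"
  proof (intro exI[of _ "C * real k"] allI impI)
    fix K L :: "(real^'n) convex_body"
    assume KL: "body_set K \<subseteq> cball 0 R" "body_set L \<subseteq> cball 0 R"
    have "\<bar>polarized_vol (replicate k K @ Ls) - polarized_vol (replicate k L @ Ls)\<bar> \<le>
        C * sum_list (map2 dist (replicate k K @ Ls) (replicate k L @ Ls))"
    proof (rule C[rule_format])
      fix M
      assume "M \<in> set (replicate k K @ Ls) \<union> set (replicate k L @ Ls)"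
      then have "M = K \<or> M = L \<or> M \<in> set Ls"
        by auto
      then show "body_set M \<subseteq> cball 0 (max R S)"
        using KL S(2) sub by blast
    qed (use assms in simp_all)
    then show "\<bar>polarized_vol (replicate k K @ Ls) - polarized_vol (replicate k L @ Ls)\<bar> \<le> C * real k * dist K L"
      unfolding dist by (simp add: mult.assoc)
  qed
qed

section \<open>Mixed volumes as valuations\<close>

text \<open>The bodies \<open>U\<close> and \<open>I\<close> are the union and the intersection of \<open>K\<close> and \<open>L\<close>; as a relation between bodies
  this is stable under Minkowski addition and dilation.\<close>

definition union_split ::
  "'a::euclidean_space convex_body \<Rightarrow> 'a convex_body \<Rightarrow> 'a convex_body \<Rightarrow> 'a convex_body \<Rightarrow> bool" where
  "union_split K L U I \<longleftrightarrow> body_set U = body_set K \<union> body_set L \<and> body_set I = body_set K \<inter> body_set L"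

text \<open>The inclusion that needs an argument is \<open>(K + M) \<inter> (L + M) \<subseteq> (K \<inter> L) + M\<close>. If \<open>z = x + m = y + m'\<close>, the
  segment from \<open>x\<close> to \<open>y\<close> stays in the convex set \<open>K \<union> L\<close>, so by connectedness it meets \<open>K \<inter> L\<close>; the same
  convex combination of \<open>m\<close> and \<open>m'\<close> then completes the point found to \<open>z\<close>.\<close>

lemma union_split_plus:
  fixes K L U I M :: "'a::euclidean_space convex_body"
  assumes "union_split K L U I"
  shows "union_split (K + M) (L + M) (U + M) (I + M)"
proof -
  have U: "body_set U = body_set K \<union> body_set L" and I: "body_set I = body_set K \<inter> body_set L"
    using assms by (simp_all add: union_split_def)
  have "body_set (K + M) \<inter> body_set (L + M) \<subseteq> body_set (I + M)"
  proof
    fix z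
    assume z: "z \<in> body_set (K + M) \<inter> body_set (L + M)"
    obtain x m where x: "z = x + m" "x \<in> body_set K" "m \<in> body_set M"
      using z unfolding body_set_plus by blast
    obtain y m' where y: "z = y + m'" "y \<in> body_set L" "m' \<in> body_set M"
      using z unfolding body_set_plus by blast
    have "closed_segment x y \<subseteq> body_set K \<union> body_set L"
      using x(2) y(2) body_set_convex[of U] unfolding U by (intro closed_segment_subset) auto
    moreover have "closed (body_set K)" "closed (body_set L)"
      by (simp_all add: compact_imp_closed body_set_compact)
    moreover have "x \<in> body_set K \<inter> closed_segment x y" "y \<in> body_set L \<inter> closed_segment x y"
      using x(2) y(2) by auto
    ultimately obtain w where w: "w \<in> closed_segment x y" "w \<in> body_set K" "w \<in> body_set L"
      using connected_closedD[OF connected_segment(1)[of x y], of "body_set K" "body_set L"] by blast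
    from w(1) obtain s where s: "0 \<le> s" "s \<le> 1" "w = (1 - s) *\<^sub>R x + s *\<^sub>R y"
      by (auto simp: in_segment)
    have "(1 - s) *\<^sub>R m + s *\<^sub>R m' \<in> body_set M"
      using s x(3) y(3) by (intro convexD[OF body_set_convex]) auto
    moreover have "z = w + ((1 - s) *\<^sub>R m + s *\<^sub>R m')"
    proof -
      have "z = (1 - s) *\<^sub>R (x + m) + s *\<^sub>R (y + m')"
        unfolding x(1)[symmetric] y(1)[symmetric] by (simp add: algebra_simps)
      then show ?thesis
        by (simp add: s(3) algebra_simps)
    qed
    ultimately show "z \<in> body_set (I + M)"
      using w(2,3) unfolding body_set_plus I by blast
  qed
  moreover have "body_set (I + M) \<subseteq> body_set (K + M) \<inter> body_set (L + M)"
    unfolding body_set_plus I by blast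
  moreover have "body_set (U + M) = body_set (K + M) \<union> body_set (L + M)"
    unfolding body_set_plus U by blast
  ultimately show ?thesis
    unfolding union_split_def by blast
qed

lemma union_split_scale:
  fixes K L U I :: "'a::euclidean_space convex_body"
  assumes "union_split K L U I"
  shows "union_split (t *\<^sub>R K) (t *\<^sub>R L) (t *\<^sub>R U) (t *\<^sub>R I)"
proof (cases "t = 0")
  case True
  then show ?thesis
    by (simp add: union_split_def body_scale_zero)
next
  case False
  then have "inj (\<lambda>x::'a. t *\<^sub>R x)"
    by (simp add: inj_def)
  with assms show ?thesis
    by (simp add: union_split_def body_set_scaleR image_Un image_Int)
qed

lemma body_vol_union_split:
  "union_split K L U I \<Longrightarrow> body_vol K + body_vol L = body_vol U + body_vol I"
  using measure_Un3[OF lmeasurable_compact lmeasurable_compact, OF body_set_compact body_set_compact, of K L]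
  by (simp add: union_split_def body_vol_def)

text \<open>The multiple \<open>j\<close> records how often the varying body has been added already; the claim is an identity
  between volumes of \<open>j K + M\<close> for all \<open>j\<close> and \<open>M\<close>.\<close>

lemma idiff_body_vol_union_split:
  assumes split: "union_split K L U I"
  shows "idiff body_vol (replicate k K @ Ms) (real j *\<^sub>R K + M) + idiff body_vol (replicate k L @ Ms) (real j *\<^sub>R L + M) =
    idiff body_vol (replicate k U @ Ms) (real j *\<^sub>R U + M) + idiff body_vol (replicate k I @ Ms) (real j *\<^sub>R I + M)"
proof (induction k arbitrary: j)
  case 0
  show ?case
  proof (induction Ms arbitrary: M)
    case Nil
    show ?case
      using body_vol_union_split[OF union_split_plus[OF union_split_scale[OF split]]] by simp
  next
    case (Cons N Ms)
    from Cons[of "M + N"] Cons[of M] show ?case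
      by (simp add: add.assoc)
  qed
next
  case (Suc k)
  have "real j *\<^sub>R N + M + N = real (Suc j) *\<^sub>R N + M" for N :: "'a convex_body"
    using body_add_scale[of "real j" 1 N] by (simp add: body_scale_one ac_simps)
  with Suc[of j] Suc[of "Suc j"] show ?case
    by simp
qed

definition translate_of :: "'a::euclidean_space convex_body \<Rightarrow> 'a convex_body \<Rightarrow> bool" where
  "translate_of K L \<longleftrightarrow> (\<exists>a. body_set L = (\<lambda>x. a + x) ` body_set K)"

lemma translate_of_refl: "translate_of K K"
  unfolding translate_of_def by (intro exI[of _ 0]) simp

lemma translate_of_plus:
  assumes "translate_of K K'" "translate_of L L'"
  shows "translate_of (K + L) (K' + L')"
proof -
  obtain a b where K: "body_set K' = (\<lambda>x. a + x) ` body_set K"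
    and L: "body_set L' = (\<lambda>x. b + x) ` body_set L"
    using assms by (auto simp: translate_of_def)
  have "body_set (K' + L') = (\<lambda>x. (a + b) + x) ` body_set (K + L)"
  proof (intro antisym subsetI)
    fix z
    assume "z \<in> body_set (K' + L')"
    then obtain x y where "z = (a + x) + (b + y)" "x \<in> body_set K" "y \<in> body_set L"
      unfolding body_set_plus K L by blast
    then show "z \<in> (\<lambda>x. (a + b) + x) ` body_set (K + L)"
      unfolding body_set_plus by (intro image_eqI[of _ _ "x + y"]) (auto simp: ac_simps)
  next
    fix z
    assume "z \<in> (\<lambda>x. (a + b) + x) ` body_set (K + L)"
    then obtain x y where "z = (a + b) + (x + y)" "x \<in> body_set K" "y \<in> body_set L"
      unfolding body_set_plus by blast
    moreover have "(a + b) + (x + y) = (a + x) + (b + y)"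
      by (simp add: ac_simps)
    ultimately show "z \<in> body_set (K' + L')"
      unfolding body_set_plus K L by blast
  qed
  then show ?thesis
    unfolding translate_of_def by blast
qed

lemma idiff_body_vol_translate:
  assumes "list_all2 translate_of Ks Ls" "translate_of X Y"
  shows "idiff body_vol Ks X = idiff body_vol Ls Y"
  using assms
proof (induction arbitrary: X Y rule: list_all2_induct)
  case Nil
  then show ?case
    by (auto simp: translate_of_def body_vol_def measure_translation)
next
  case (Cons K Ks L Ls)
  then show ?case
    by (simp add: translate_of_plus)
qed

lemma polarized_vol_scale_replicate:
  fixes Ls :: "(real^'n) convex_body list"
  assumes "k + length Ls = CARD('n)" "0 \<le> t"
  shows "polarized_vol (replicate k (t *\<^sub>R K) @ Ls) = t ^ k * polarized_vol (replicate k K @ Ls)"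
  using assms(1)
proof (induction k arbitrary: Ls)
  case (Suc k)
  have "polarized_vol (replicate (Suc k) (t *\<^sub>R K) @ Ls) = t * polarized_vol (K # replicate k (t *\<^sub>R K) @ Ls)"
    using Suc.prems assms(2) by (simp add: polarized_vol_scale)
  also have "polarized_vol (K # replicate k (t *\<^sub>R K) @ Ls) = polarized_vol (replicate k (t *\<^sub>R K) @ K # Ls)"
    by (rule polarized_vol_mset) simp
  also have "\<dots> = t ^ k * polarized_vol (replicate k K @ K # Ls)"
    using Suc.prems by (intro Suc.IH) simp
  also have "polarized_vol (replicate k K @ K # Ls) = polarized_vol (replicate (Suc k) K @ Ls)"
    by (rule polarized_vol_mset) simp
  finally show ?case
    by simp
qed simp

lemma polarized_vol_in_Val:
  fixes Ls :: "(real^'n) convex_body list"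
  assumes "k + length Ls = CARD('n)"
  shows "(\<lambda>K. polarized_vol (replicate k K @ Ls)) \<in> Val k"
  unfolding Val_def mem_Collect_eq
proof (intro conjI)
  show "valuation (\<lambda>K. polarized_vol (replicate k K @ Ls))"
    unfolding valuation_def
  proof (intro allI impI)
    fix K L :: "(real^'n) convex_body"
    assume "convex (body_set K \<union> body_set L)"
    then have "union_split K L (Body (body_set K \<union> body_set L)) (Body (body_set K \<inter> body_set L))"
      by (simp add: union_split_def body_set_Body_Un_Int)
    from idiff_body_vol_union_split[OF this, of k Ls 0 0]
    show "polarized_vol (replicate k K @ Ls) + polarized_vol (replicate k L @ Ls) =
        polarized_vol (replicate k (Body (body_set K \<union> body_set L)) @ Ls) +
        polarized_vol (replicate k (Body (body_set K \<inter> body_set L)) @ Ls)"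
      by (simp add: polarized_vol_def body_scale_zero add_divide_distrib[symmetric])
  qed
  show "continuous_on UNIV (\<lambda>K. polarized_vol (replicate k K @ Ls))"
    by (intro locally_lipschitz_imp_continuous locally_lipschitz_polarized_vol assms)
  show "translation_invariant (\<lambda>K. polarized_vol (replicate k K @ Ls))"
    unfolding translation_invariant_def
  proof (intro allI)
    fix a and K :: "(real^'n) convex_body"
    have "translate_of K (body_translate a K)"
      unfolding translate_of_def body_translate.rep_eq by blast
    then have "list_all2 translate_of (replicate k K @ Ls) (replicate k (body_translate a K) @ Ls)"
      by (intro list_all2_appendI) (auto simp: list_all2_conv_all_nth translate_of_refl)
    then show "polarized_vol (replicate k (body_translate a K) @ Ls) = polarized_vol (replicate k K @ Ls)"
      unfolding polarized_vol_def using idiff_body_vol_translate[OF _ translate_of_refl] by metis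
  qed
  show "homogeneous k (\<lambda>K. polarized_vol (replicate k K @ Ls))"
    unfolding homogeneous_def using polarized_vol_scale_replicate[OF assms] by blast
qed

text \<open>A normal convergence criterion: each defining property of \<open>Val k\<close> passes to limits that are uniform
  on bounded sets of bodies.\<close>

lemma suminf_in_Val:
  fixes \<mu> :: "nat \<Rightarrow> 'a::euclidean_space convex_body \<Rightarrow> real"
  assumes Val: "\<And>i. \<mu> i \<in> Val k"
    and bound: "\<And>R. 0 < R \<Longrightarrow> \<exists>C. summable C \<and> (\<forall>i K. body_set K \<subseteq> cball 0 R \<longrightarrow> \<bar>\<mu> i K\<bar> \<le> C i)"
  shows "(\<lambda>K. \<Sum>i. \<mu> i K) \<in> Val k"
    and "summable (\<lambda>i. \<mu> i K)"
proof -
  show sm: "summable (\<lambda>i. \<mu> i K)" for K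
  proof -
    obtain r where r: "r > 0" "body_set K \<subseteq> cball 0 r"
      using body_subset_cball by blast
    obtain C where C: "summable C" "\<forall>i K. body_set K \<subseteq> cball 0 r \<longrightarrow> \<bar>\<mu> i K\<bar> \<le> C i"
      using bound[OF r(1)] by (elim exE conjE)
    show ?thesis
      by (rule summable_comparison_test'[OF C(1), of 0]) (use C(2) r(2) in simp)
  qed
  have "valuation (\<lambda>K. \<Sum>i. \<mu> i K)"
    unfolding valuation_def
  proof (intro allI impI)
    fix K L :: "'a convex_body"
    assume cvx: "convex (body_set K \<union> body_set L)"
    have "\<mu> i K + \<mu> i L = \<mu> i (Body (body_set K \<union> body_set L)) + \<mu> i (Body (body_set K \<inter> body_set L))" for i
      using Val[of i] cvx unfolding Val_def valuation_def by blast
    then show "(\<Sum>i. \<mu> i K) + (\<Sum>i. \<mu> i L) =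
        (\<Sum>i. \<mu> i (Body (body_set K \<union> body_set L))) + (\<Sum>i. \<mu> i (Body (body_set K \<inter> body_set L)))"
      by (simp add: suminf_add sm)
  qed
  moreover have "continuous_on UNIV (\<lambda>K. \<Sum>i. \<mu> i K)"
  proof (rule continuous_at_imp_continuous_on, rule ballI)
    fix K :: "'a convex_body"
    obtain r where r: "r > 0" "body_set K \<subseteq> cball 0 r"
      using body_subset_cball by blast
    have "r + 1 > 0"
      using r(1) by simp
    from bound[OF this] obtain C where
      C: "summable C" "\<forall>i K. body_set K \<subseteq> cball 0 (r + 1) \<longrightarrow> \<bar>\<mu> i K\<bar> \<le> C i"
      by (elim exE conjE)
    have "uniform_limit (ball K 1) (\<lambda>m K. \<Sum>i<m. \<mu> i K) (\<lambda>K. \<Sum>i. \<mu> i K) sequentially"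
      using C neighbour_subset_cball[OF r(2)] by (intro Weierstrass_m_test[of _ _ C]) auto
    moreover have "continuous_on (ball K 1) (\<lambda>K. \<Sum>i<m. \<mu> i K)" for m
      using Val unfolding Val_def by (intro continuous_on_sum) (auto intro: continuous_on_subset)
    ultimately have "continuous_on (ball K 1) (\<lambda>K. \<Sum>i. \<mu> i K)"
      by (intro uniform_limit_theorem) auto
    then show "isCont (\<lambda>K. \<Sum>i. \<mu> i K) K"
      by (simp add: continuous_on_eq_continuous_at)
  qed
  moreover have "translation_invariant (\<lambda>K. \<Sum>i. \<mu> i K)"
    using Val by (simp add: Val_def translation_invariant_def)
  moreover have "homogeneous k (\<lambda>K. \<Sum>i. \<mu> i K)"
    using Val by (simp add: Val_def homogeneous_def suminf_mult sm)
  ultimately show "(\<lambda>K. \<Sum>i. \<mu> i K) \<in> Val k"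
    unfolding Val_def by blast
qed

section \<open>Volumes of parallelotopes\<close>

text \<open>The matrix of a shear arises from the identity by a row operation.\<close>

lemma measure_shear_wellorder:
  fixes S :: "(real^'m::{finite,wellorder}) set"
  assumes "p \<noteq> q" "S \<in> lmeasurable"
  shows "measure lebesgue ((\<lambda>x. x + (t * x $ p) *\<^sub>R axis q 1) ` S) = measure lebesgue S"
proof -
  let ?h = "\<lambda>x::(real,'m) vec. x + (t * x $ p) *\<^sub>R axis q 1"
  have lin: "linear ?h"
    by (rule linearI) (simp_all add: algebra_simps)
  have "matrix ?h = (\<chi> k. if k = q then row q (mat 1) + t *s row p (mat 1) else row k (mat 1))"
    by (auto simp: matrix_def row_def vec_eq_iff mat_def axis_def)
  then have "det (matrix ?h) = 1"
    using det_row_operation[of q p "mat 1 :: ((real,'m) vec,'m) vec" t] assms(1) by simp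
  then show ?thesis
    using measure_linear_image[OF lin assms(2)] by simp
qed

lemma measure_shear:
  fixes S :: "(real^'n) set"
  assumes "p \<noteq> q" "compact S"
  shows "measure lebesgue ((\<lambda>x. x + (t * x $ p) *\<^sub>R axis q 1) ` S) = measure lebesgue S"
proof -
  obtain f :: "'n ranked \<Rightarrow> 'n" where f: "bij f"
    using ranked_bij by blast
  define g where "g = inv f"
  have fg: "f (g j) = j" for j
    using f by (simp add: g_def bij_is_surj surj_f_inv_f)
  define T :: "real^'n \<Rightarrow> real^'n ranked" where "T x = (\<chi> i. x $ f i)" for x
  define h where "h x = x + (t * x $ p) *\<^sub>R axis q 1" for x :: "real^'n"
  define h' where "h' x = x + (t * x $ g p) *\<^sub>R axis (g q) 1" for x :: "real^'n ranked"
  have T_meas: "measure lebesgue (T ` K) = measure lebesgue K" if "compact K" for K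
    using measure_reindex_coordinates[OF f that] by (simp add: T_def[abs_def])
  have lin: "linear T" "linear h"
    by (rule linearI; simp add: T_def h_def vec_eq_iff algebra_simps)+
  then have cont: "continuous_on K T" "continuous_on K h" for K
    by (simp_all add: linear_continuous_on linear_conv_bounded_linear)
  have eq: "f i = q \<longleftrightarrow> i = g q" for i
    using f fg by (metis bij_is_inj g_def inv_f_f)
  have "T (h x) = h' (T x)" for x
    by (simp add: T_def h_def h'_def vec_eq_iff axis_def fg eq)
  then have "T ` h ` S = h' ` T ` S"
    by (simp add: image_image)
  have "measure lebesgue (h ` S) = measure lebesgue (T ` h ` S)"
    using assms(2) cont by (intro T_meas[symmetric] compact_continuous_image)
  also have "\<dots> = measure lebesgue (h' ` T ` S)"
    by (simp only: \<open>T ` h ` S = h' ` T ` S\<close>)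
  also have "\<dots> = measure lebesgue (T ` S)"
  proof -
    have "g p \<noteq> g q"
      using fg assms(1) by metis
    moreover have "T ` S \<in> lmeasurable"
      using assms(2) cont by (intro lmeasurable_compact compact_continuous_image)
    ultimately show ?thesis
      unfolding h'_def[abs_def] by (rule measure_shear_wellorder)
  qed
  also have "\<dots> = measure lebesgue S"
    using assms(2) by (rule T_meas)
  finally show ?thesis
    by (simp add: h_def[abs_def])
qed

definition segment_body :: "'a::euclidean_space \<Rightarrow> 'a convex_body" where
  "segment_body v = Body (closed_segment 0 v)"

lemma body_set_segment: "body_set (segment_body v) = closed_segment 0 v"
  unfolding segment_body_def by (intro Body_inverse) simp

lemma linear_image_segment: "linear h \<Longrightarrow> linear_image_body h (segment_body v) = segment_body (h v)"
  by (rule body_eqI)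
     (simp add: body_set_linear_image body_set_segment closed_segment_linear_image[symmetric] linear_0)

lemma scale_segment: "t *\<^sub>R segment_body v = segment_body (t *\<^sub>R v)"
  by (rule body_eqI) (simp add: body_set_scaleR body_set_segment closed_segment_linear_image[symmetric])

definition box_body :: "('n \<Rightarrow> real) \<Rightarrow> 'n list \<Rightarrow> (real^'n) convex_body" where
  "box_body h is = (\<Sum>i\<leftarrow>is. segment_body (h i *\<^sub>R axis i 1))"

lemma scale_box: "t *\<^sub>R box_body h is = box_body (\<lambda>i. t * h i) is"
  by (induction "is") (simp_all add: box_body_def body_scale_zero_right body_scale_add scale_segment)

lemma box_append: "box_body h (is @ js) = box_body h is + box_body h js"
  by (simp add: box_body_def)

lemma box_cong: "(\<And>i. i \<in> set is \<Longrightarrow> h i = h' i) \<Longrightarrow> box_body h is = box_body h' is"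
  unfolding box_body_def by (intro arg_cong[of _ _ sum_list] map_cong) auto

lemma body_set_box:
  assumes "distinct is"
  shows "body_set (box_body h is) =
    {x. \<forall>i. if i \<in> set is then x $ i \<in> closed_segment 0 (h i) else x $ i = 0}"
  using assms
proof (induction "is")
  case Nil
  show ?case
    by (auto simp: box_body_def body_set_zero vec_eq_iff)
next
  case (Cons j js)
  have seg: "body_set (segment_body (h j *\<^sub>R axis j 1)) = (\<lambda>s. s *\<^sub>R axis j 1) ` closed_segment 0 (h j)"
    by (auto simp: body_set_segment closed_segment_def image_def)
  have "body_set (box_body h (j # js)) =
      {s *\<^sub>R axis j 1 + y | s y. s \<in> closed_segment 0 (h j) \<and> y \<in> body_set (box_body h js)}"
    unfolding box_body_def by (auto simp: body_set_plus seg)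
  also have "\<dots> = {x. \<forall>i. if i \<in> set (j # js) then x $ i \<in> closed_segment 0 (h i) else x $ i = 0}"
    (is "?A = ?B")
  proof (intro antisym subsetI)
    fix x assume "x \<in> ?A"
    then obtain s y where x: "x = s *\<^sub>R axis j 1 + y" "s \<in> closed_segment 0 (h j)" "y \<in> body_set (box_body h js)"
      by blast
    have y: "if i \<in> set js then y $ i \<in> closed_segment 0 (h i) else y $ i = 0" for i
      using x(3) Cons by simp
    show "x \<in> ?B"
      using x(1,2) y[of j] y Cons.prems by (auto simp: axis_def)
  next
    fix x assume x: "x \<in> ?B"
    define y where "y = (\<chi> i. if i = j then 0 else x $ i)"
    have "x = (x $ j) *\<^sub>R axis j 1 + y"
      by (simp add: y_def vec_eq_iff axis_def)
    moreover have "x $ j \<in> closed_segment 0 (h j)"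
      using x by (auto dest: spec[of _ j])
    moreover have "y \<in> body_set (box_body h js)"
      using x Cons by (auto simp: y_def)
    ultimately show "x \<in> ?A"
      by blast
  qed
  finally show ?case .
qed

lemma body_vol_box:
  fixes h :: "'n::finite \<Rightarrow> real"
  assumes "distinct is" "set is = UNIV"
  shows "body_vol (box_body h is) = (\<Prod>i\<in>UNIV. \<bar>h i\<bar>)"
proof -
  have "closed_segment 0 (h i) = {min 0 (h i)..max 0 (h i)}" for i
    by (auto simp: closed_segment_eq_real_ivl)
  then have "body_set (box_body h is) = cbox (\<chi> i. min 0 (h i)) (\<chi> i. max 0 (h i))"
    unfolding body_set_box[OF assms(1)] assms(2) by (simp add: set_eq_iff mem_box_cart)
  moreover have "cbox (\<chi> i. min 0 (h i)) (\<chi> i. max 0 (h i)) \<noteq> {}"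
    by (simp add: interval_ne_empty_cart min_le_iff_disj le_max_iff_disj)
  ultimately have "body_vol (box_body h is) = (\<Prod>i\<in>UNIV. max 0 (h i) - min 0 (h i))"
    by (simp add: body_vol_def content_cbox_cart)
  moreover have "max 0 (h i) - min 0 (h i) = \<bar>h i\<bar>" for i
    by linarith
  ultimately show ?thesis
    by simp
qed

lemma body_vol_flat:
  assumes "u \<noteq> 0" "body_set K \<subseteq> {x. u \<bullet> x = 0}"
  shows "body_vol K = 0"
  unfolding body_vol_def
  using negligible_subset[OF negligible_hyperplane assms(2)] assms(1) negligible_imp_measure0 by blast

lemma flat_plus:
  "body_set K \<subseteq> {x. u \<bullet> x = 0} \<Longrightarrow> body_set L \<subseteq> {x. u \<bullet> x = 0} \<Longrightarrow>
    body_set (K + L) \<subseteq> {x. u \<bullet> x = 0}"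
  unfolding body_set_plus by (fastforce simp: inner_add_right)

lemma idiff_body_vol_flat:
  assumes "u \<noteq> 0" "\<forall>K\<in>set Ks. body_set K \<subseteq> {x. u \<bullet> x = 0}" "body_set X \<subseteq> {x. u \<bullet> x = 0}"
  shows "idiff body_vol Ks X = 0"
  using assms(2,3)
proof (induction Ks arbitrary: X)
  case Nil
  then show ?case
    using body_vol_flat[OF assms(1)] by simp
next
  case (Cons K Ks)
  then show ?case
    by (simp add: flat_plus)
qed

text \<open>Partial sums that omit \<open>L\<close> lie in a hyperplane and have no volume, so they drop out of the
  alternating sum.\<close>

lemma idiff_body_vol_peel:
  assumes "u \<noteq> 0" "\<forall>K\<in>set Ks. body_set K \<subseteq> {x. u \<bullet> x = 0}" "body_set X \<subseteq> {x. u \<bullet> x = 0}"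
  shows "idiff body_vol (L # Ks) X = idiff body_vol Ks (X + L)"
  using idiff_body_vol_flat[OF assms] by simp

lemma segment_flat: "u \<bullet> v = 0 \<Longrightarrow> body_set (segment_body v) \<subseteq> {x. u \<bullet> x = 0}"
  by (auto simp: body_set_segment closed_segment_def)

lemma box_flat:
  assumes "\<And>i. i \<in> set is \<Longrightarrow> u $ i = 0"
  shows "body_set (box_body h is) \<subseteq> {x. u \<bullet> x = 0}"
  using assms
proof (induction "is")
  case Nil
  show ?case
    by (simp add: box_body_def body_set_zero)
next
  case (Cons i "is")
  have "body_set (segment_body (h i *\<^sub>R axis i 1) + box_body h is) \<subseteq> {x. u \<bullet> x = 0}"
    using Cons by (intro flat_plus segment_flat) (simp_all add: inner_axis)
  then show ?case
    by (simp add: box_body_def)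
qed

lemma idiff_body_vol_peel_box:
  fixes Ks :: "(real^'n) convex_body list"
  assumes "distinct ds"
    and "\<And>d K. d \<in> set ds \<Longrightarrow> K \<in> set Ks \<Longrightarrow> body_set K \<subseteq> {x. axis d 1 \<bullet> x = 0}"
    and "\<And>d. d \<in> set ds \<Longrightarrow> body_set X \<subseteq> {x. axis d 1 \<bullet> x = 0}"
  shows "idiff body_vol (map (\<lambda>d. segment_body (axis d 1)) ds @ Ks) X =
    idiff body_vol Ks (X + box_body (\<lambda>_. 1) ds)"
  using assms
proof (induction ds arbitrary: X)
  case Nil
  show ?case
    by (simp add: box_body_def)
next
  case (Cons d ds)
  have other: "body_set (segment_body (axis i 1)) \<subseteq> {x. axis j 1 \<bullet> x = 0}" if "i \<noteq> j" for i j :: 'n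
    using that by (intro segment_flat) (simp add: inner_axis_axis)
  have "idiff body_vol (map (\<lambda>d. segment_body (axis d 1)) (d # ds) @ Ks) X =
      idiff body_vol (map (\<lambda>d. segment_body (axis d 1)) ds @ Ks) (X + segment_body (axis d 1))"
  proof (simp only: list.map append_Cons, rule idiff_body_vol_peel)
    show "axis d 1 \<noteq> (0 :: real^'n)"
      by (simp add: axis_eq_0_iff)
    show "\<forall>K\<in>set (map (\<lambda>d. segment_body (axis d 1)) ds @ Ks). body_set K \<subseteq> {x. axis d 1 \<bullet> x = 0}"
    proof
      fix K
      assume "K \<in> set (map (\<lambda>d. segment_body (axis d 1)) ds @ Ks)"
      then consider i where "i \<in> set ds" "K = segment_body (axis i 1)" | "K \<in> set Ks"
        by auto
      then show "body_set K \<subseteq> {x. axis d 1 \<bullet> x = 0}"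
      proof cases
        case 1
        then show ?thesis
          using Cons.prems(1) other[of i d] by auto
      next
        case 2
        then show ?thesis
          using Cons.prems(2) by simp
      qed
    qed
    show "body_set X \<subseteq> {x. axis d 1 \<bullet> x = 0}"
      using Cons.prems(3) by simp
  qed
  also have "\<dots> = idiff body_vol Ks (X + segment_body (axis d 1) + box_body (\<lambda>_. 1) ds)"
  proof (rule Cons.IH)
    show "body_set (X + segment_body (axis d 1)) \<subseteq> {x. axis d' 1 \<bullet> x = 0}" if "d' \<in> set ds" for d'
      using that Cons.prems(1,3) other[of d d'] by (intro flat_plus) auto
  qed (use Cons.prems in auto)
  finally show ?case
    by (simp add: box_body_def add.assoc)
qed

lemma body_vol_shear_parallelotope:
  fixes a b :: "real^'n"
  assumes "p \<noteq> q" "p \<notin> set is"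
  shows "body_vol (segment_body (a + (t * a $ p) *\<^sub>R axis q 1) +
      (segment_body (b + (t * b $ p) *\<^sub>R axis q 1) + box_body h is)) =
    body_vol (segment_body a + (segment_body b + box_body h is))"
proof -
  let ?s = "\<lambda>x::real^'n. x + (t * x $ p) *\<^sub>R axis q 1"
  have lin: "linear ?s"
    by (rule linearI) (simp_all add: algebra_simps)
  have "linear_image_body ?s (box_body h is) = box_body h is"
    using assms(2)
  proof (induction "is")
    case Nil
    show ?case
      by (rule body_eqI) (simp add: box_body_def body_set_linear_image[OF lin] body_set_zero)
  next
    case (Cons i "is")
    then have "axis i (1::real) $ p = 0"
      by (simp add: axis_def)
    with Cons show ?case
      by (simp add: box_body_def linear_image_body_plus[OF lin] linear_image_segment[OF lin])
  qed
  then have "segment_body (?s a) + (segment_body (?s b) + box_body h is) =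
      linear_image_body ?s (segment_body a + (segment_body b + box_body h is))"
    by (simp add: linear_image_body_plus[OF lin] linear_image_segment[OF lin])
  then show ?thesis
    using measure_shear[OF assms(1) body_set_compact]
    by (simp add: body_vol_def body_set_linear_image[OF lin])
qed

text \<open>Unless the first two edges are parallel, two shears in the plane of \<open>p\<close> and \<open>q\<close> bring the
  parallelotope into the position of a coordinate box, which has edges \<open>x\<close> and \<open>\<bar>d - t\<bar>\<close> in that plane;
  they fix the other edges.\<close>

lemma body_vol_parallelotope:
  fixes p q :: "'n::finite"
  assumes "distinct (p # q # is)" "set (p # q # is) = UNIV"
  shows "body_vol (segment_body (x *\<^sub>R (axis p 1 + t *\<^sub>R axis q 1)) +
      (segment_body (axis p 1 + d *\<^sub>R axis q 1) + box_body h is)) =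
    \<bar>x\<bar> * \<bar>t - d\<bar> * (\<Prod>i\<in>set is. \<bar>h i\<bar>)"
    (is "body_vol (segment_body ?a + (segment_body ?b + ?B)) = _")
proof (cases "t = d")
  case True
  let ?u = "axis q 1 - t *\<^sub>R axis p 1 :: real^'n"
  have pq: "q \<noteq> p" "p \<noteq> q" "p \<notin> set is" "q \<notin> set is"
    using assms(1) by auto
  then have "?u $ q = 1"
    by (simp add: axis_def)
  then have "?u \<noteq> 0"
    by (metis zero_index zero_neq_one)
  moreover have "body_set (segment_body ?a + (segment_body ?b + ?B)) \<subseteq> {x. ?u \<bullet> x = 0}"
  proof (intro flat_plus segment_flat box_flat)
    show "?u \<bullet> ?a = 0" "?u \<bullet> ?b = 0"
      using pq True by (simp_all add: inner_axis_axis inner_add_right inner_diff_left)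
    show "?u $ i = 0" if "i \<in> set is" for i
      using pq that by (auto simp: axis_def)
  qed
  ultimately have "body_vol (segment_body ?a + (segment_body ?b + ?B)) = 0"
    by (rule body_vol_flat)
  then show ?thesis
    using True by simp
next
  case False
  let ?h = "h(p := x, q := d - t)"
  have pq: "p \<noteq> q" "p \<notin> set is" "q \<notin> set is"
    using assms(1) by auto
  have "body_vol (segment_body ?a + (segment_body ?b + ?B)) =
      body_vol (segment_body (x *\<^sub>R axis p 1) + (segment_body (axis p 1 + (d - t) *\<^sub>R axis q 1) + ?B))"
  proof -
    have e1: "?a + (- t * ?a $ p) *\<^sub>R axis q 1 = x *\<^sub>R axis p 1"
      using pq by (simp add: vec_eq_iff axis_def algebra_simps)
    have e2: "?b + (- t * ?b $ p) *\<^sub>R axis q 1 = axis p 1 + (d - t) *\<^sub>R axis q 1"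
      using pq by (simp add: vec_eq_iff axis_def algebra_simps)
    show ?thesis
      using body_vol_shear_parallelotope[OF pq(1,2), of ?a "- t" ?b h] unfolding e1 e2 by (rule sym)
  qed
  also have "\<dots> = body_vol (segment_body (x *\<^sub>R axis p 1) + (segment_body ((d - t) *\<^sub>R axis q 1) + ?B))"
  proof -
    let ?c = "axis p 1 + (d - t) *\<^sub>R axis q 1 :: real^'n" and ?e = "x *\<^sub>R axis p 1 :: real^'n"
    let ?s = "- 1 / (d - t)"
    have e1: "?e + (?s * ?e $ q) *\<^sub>R axis p 1 = ?e"
      using pq by (simp add: vec_eq_iff axis_def)
    have e2: "?c + (?s * ?c $ q) *\<^sub>R axis p 1 = (d - t) *\<^sub>R axis q 1"
      using pq False by (simp add: vec_eq_iff axis_def)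
    show ?thesis
      using body_vol_shear_parallelotope[OF pq(1)[symmetric] pq(3), of ?e ?s ?c h]
      unfolding e1 e2 by (rule sym)
  qed
  also have "segment_body (x *\<^sub>R axis p 1) + (segment_body ((d - t) *\<^sub>R axis q 1) + ?B) = box_body ?h (p # q # is)"
  proof -
    have "box_body ?h is = ?B"
      using pq by (intro box_cong) auto
    moreover have "box_body ?h (p # q # is) =
        segment_body (?h p *\<^sub>R axis p 1) + (segment_body (?h q *\<^sub>R axis q 1) + box_body ?h is)"
      by (simp add: box_body_def)
    ultimately show ?thesis
      using pq by simp
  qed
  also have "body_vol \<dots> = (\<Prod>i\<in>set (p # q # is). \<bar>?h i\<bar>)"
    using body_vol_box[OF assms, of ?h] assms(2) by simp
  also have "\<dots> = \<bar>x\<bar> * (\<bar>d - t\<bar> * (\<Prod>i\<in>set is. \<bar>?h i\<bar>))"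
    using pq by simp
  also have "(\<Prod>i\<in>set is. \<bar>?h i\<bar>) = (\<Prod>i\<in>set is. \<bar>h i\<bar>)"
    using pq by (intro prod.cong) auto
  finally show ?thesis
    by (simp add: abs_minus_commute)
qed

section \<open>A valuation that is not locally Lipschitz\<close>

definition slanted_box :: "'n::finite \<Rightarrow> 'n \<Rightarrow> 'n list \<Rightarrow> real \<Rightarrow> (real^'n) convex_body" where
  "slanted_box p q cs t = segment_body (axis p 1 + t *\<^sub>R axis q 1) + box_body (\<lambda>_. 1) cs"

text \<open>In the alternating sum every partial sum that omits one of the segments is flat. What remains
  is the \<open>k\<close>-fold difference, along multiples of the slanted box, of the volume of a parallelotope,
  and this volume is \<open>\<bar>t - d\<bar>\<close> times the \<open>k\<close>-th power of the multiple.\<close>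

lemma polarized_vol_slanted_box:
  fixes p q :: "'n::finite"
  assumes "distinct (p # q # cs @ ds)" "set (p # q # cs @ ds) = UNIV"
  shows "polarized_vol (replicate (Suc (length cs)) (slanted_box p q cs t) @
      segment_body (axis p 1 + d *\<^sub>R axis q 1) # map (\<lambda>i. segment_body (axis i 1)) ds) =
    fact (Suc (length cs)) / fact CARD('n) * \<bar>t - d\<bar>"
proof -
  define k where "k = Suc (length cs)"
  define A where "A = slanted_box p q cs t"
  define S where "S = segment_body (axis p 1 + d *\<^sub>R axis q (1::real))"
  define D where "D = map (\<lambda>i. segment_body (axis i (1::real))) ds"
  have pq: "p \<noteq> q" "q \<noteq> p" "p \<notin> set cs" "q \<notin> set cs" "p \<notin> set ds" "q \<notin> set ds"
    and cd: "set cs \<inter> set ds = {}" "distinct cs" "distinct ds"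
    using assms(1) by auto
  \<comment> \<open>the normal of the hyperplane that contains the slanted box and the segments of D\<close>
  let ?u = "axis q 1 - t *\<^sub>R axis p 1 :: real^'n"
  have "?u $ q = 1"
    using pq by (simp add: axis_def)
  then have u: "?u \<noteq> 0"
    by (metis zero_index zero_neq_one)
  have A_flat: "body_set A \<subseteq> {x. ?u \<bullet> x = 0}"
    unfolding A_def slanted_box_def
  proof (intro flat_plus segment_flat box_flat)
    show "?u \<bullet> (axis p 1 + t *\<^sub>R axis q 1) = 0"
      using pq by (simp add: inner_axis_axis inner_add_right inner_diff_left)
    show "?u $ i = 0" if "i \<in> set cs" for i
      using pq that by (auto simp: axis_def)
  qed
  have D_flat: "body_set K \<subseteq> {x. ?u \<bullet> x = 0}" if K: "K \<in> set D" for K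
  proof -
    obtain i where i: "i \<in> set ds" "K = segment_body (axis i 1)"
      using K unfolding D_def by auto
    then have "i \<noteq> p" "i \<noteq> q"
      using pq by auto
    then show ?thesis
      unfolding i(2) by (intro segment_flat) (simp add: inner_axis_axis inner_diff_left)
  qed
  have A_axis: "body_set A \<subseteq> {x. axis i 1 \<bullet> x = 0}" if "i \<in> set ds" for i
    unfolding A_def slanted_box_def
  proof (intro flat_plus segment_flat box_flat)
    have "i \<noteq> p" "i \<noteq> q"
      using pq that by auto
    then show "axis i 1 \<bullet> (axis p 1 + t *\<^sub>R axis q 1) = (0::real)"
      by (simp add: inner_axis_axis inner_add_right)
    show "axis i (1::real) $ j = 0" if "j \<in> set cs" for j
      using that \<open>i \<in> set ds\<close> cd(1) by (auto simp: axis_def)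
  qed
  have S_axis: "body_set S \<subseteq> {x. axis i 1 \<bullet> x = 0}" if "i \<in> set ds" for i
  proof -
    have "i \<noteq> p" "i \<noteq> q"
      using pq that by auto
    then show ?thesis
      unfolding S_def by (intro segment_flat) (simp add: inner_axis_axis inner_add_right)
  qed
  have "idiff body_vol (replicate k A @ S # D) 0 = idiff body_vol (S # D @ replicate k A) 0"
    by (rule idiff_mset) simp
  also have "\<dots> = idiff body_vol (D @ replicate k A) (0 + S)"
    using A_flat D_flat by (intro idiff_body_vol_peel[OF u]) (auto simp: body_set_zero)
  also have "\<dots> = idiff body_vol (replicate k A) (S + box_body (\<lambda>_. 1) ds)"
    unfolding D_def using cd(3) A_axis S_axis by (subst idiff_body_vol_peel_box) auto
  also have "\<dots> = idiff body_vol (replicate k A) (0 *\<^sub>R A + (S + box_body (\<lambda>_. 1) ds))"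
    by (simp add: body_scale_zero)
  also have "\<dots> = idiff (\<lambda>x. \<bar>t - d\<bar> * x ^ k) (replicate k 1) 0"
  proof (rule idiff_replicate_ray)
    fix x :: real
    assume "0 \<le> x"
    define h where "h i = (if i \<in> set cs then x else 1)" for i
    have box: "box_body h (cs @ ds) = box_body (\<lambda>_. x) cs + box_body (\<lambda>_. 1) ds"
      unfolding box_append using cd(1) by (intro arg_cong2[of _ _ _ _ "(+)"] box_cong) (auto simp: h_def)
    have "x *\<^sub>R A + (S + box_body (\<lambda>_. 1) ds) =
        segment_body (x *\<^sub>R (axis p 1 + t *\<^sub>R axis q 1)) + (S + box_body h (cs @ ds))"
      unfolding box A_def slanted_box_def body_scale_add scale_segment scale_box by (simp add: ac_simps)
    then have "body_vol (x *\<^sub>R A + (S + box_body (\<lambda>_. 1) ds)) =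
        \<bar>x\<bar> * \<bar>t - d\<bar> * (\<Prod>i\<in>set (cs @ ds). \<bar>h i\<bar>)"
      using body_vol_parallelotope[OF assms, of x t d h] by (simp add: S_def)
    also have "(\<Prod>i\<in>set (cs @ ds). \<bar>h i\<bar>) = (\<Prod>i\<in>set cs. \<bar>h i\<bar>) * (\<Prod>i\<in>set ds. \<bar>h i\<bar>)"
      using cd(1) by (simp add: prod.union_disjoint)
    also have "(\<Prod>i\<in>set cs. \<bar>h i\<bar>) = \<bar>x\<bar> ^ length cs"
      using cd(2) by (simp add: h_def distinct_card)
    also have "(\<Prod>i\<in>set ds. \<bar>h i\<bar>) = 1"
      using cd(1) by (intro prod.neutral) (auto simp: h_def)
    finally show "body_vol (x *\<^sub>R A + (S + box_body (\<lambda>_. 1) ds)) = \<bar>t - d\<bar> * x ^ k"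
      using \<open>0 \<le> x\<close> by (simp add: k_def)
  qed simp
  also have "\<dots> = \<bar>t - d\<bar> * fact k"
    unfolding idiff_cmult idiff_power ..
  finally show ?thesis
    by (simp add: polarized_vol_def A_def S_def D_def k_def)
qed

lemma dist_segment_body: "dist (segment_body v) (segment_body w) \<le> norm (v - w)"
proof -
  have *: "\<exists>y\<in>closed_segment 0 w. dist x y \<le> norm (v - w)" if x: "x \<in> closed_segment 0 v" for x v w :: 'a
  proof -
    obtain s where s: "0 \<le> s" "s \<le> 1" "x = s *\<^sub>R v"
      using x by (auto simp: in_segment)
    have "dist x (s *\<^sub>R w) = s * norm (v - w)"
      using s by (simp add: dist_norm scaleR_diff_right[symmetric])
    also have "\<dots> \<le> norm (v - w)"
      using s by (simp add: mult_left_le_one_le)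
    finally show ?thesis
      using s by (intro bexI[of _ "s *\<^sub>R w"]) (auto simp: in_segment)
  qed
  show ?thesis
    unfolding body_dist_le_iff body_set_segment using *[of _ v w] *[of _ w v] by (simp add: norm_minus_commute)
qed

lemma segment_body_subset_cball: "norm v \<le> r \<Longrightarrow> body_set (segment_body v) \<subseteq> cball 0 r"
  unfolding body_set_segment
  by (rule closed_segment_subset) (auto intro: order_trans[OF norm_ge_zero])

text \<open>The weights \<open>2\<^sup>i\<close> and the slopes \<open>\<delta>\<^sub>i = 4\<^sup>-\<^sup>i\<close> are balanced so that \<open>2\<^sup>i \<delta>\<^sub>i\<close> is summable, which gives convergence,
  while the Lipschitz constants, of order \<open>2\<^sup>i\<close>, are unbounded. All terms of the increment along the bodies
  \<open>A\<^sub>t\<close> have the same sign, so no cancellation can repair this.\<close>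

lemma non_lipschitz_in_Val:
  assumes "CARD('n::finite) \<ge> 2" and "1 \<le> k" and "k \<le> CARD('n) - 1"
  shows "\<exists>\<phi>::(real^'n) convex_body \<Rightarrow> real. \<phi> \<in> Val k \<and> \<not> locally_lipschitz \<phi>"
proof -
  obtain xs :: "'n list" where xs: "distinct xs" "set xs = UNIV"
    using finite_distinct_list[of "UNIV :: 'n set"] by auto
  then have len: "length xs = CARD('n)"
    using distinct_card by fastforce
  then obtain p q ys where ys: "xs = p # q # ys"
    using assms(1) by (cases xs; cases "tl xs") auto
  define cs ds where "cs = take (k - 1) ys" and "ds = drop (k - 1) ys"
  have pq: "distinct (p # q # cs @ ds)" "set (p # q # cs @ ds) = UNIV"
    using xs by (simp_all only: ys cs_def ds_def append_take_drop_id)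
  have k: "Suc (length cs) = k" and n: "k + Suc (length ds) = CARD('n)"
    using assms len by (auto simp: ys cs_def ds_def)
  define e where "e d = axis p 1 + d *\<^sub>R axis q (1::real)" for d
  define Ls where "Ls d = segment_body (e d) # map (\<lambda>i. segment_body (axis i (1::real))) ds" for d
  define A where "A = slanted_box p q cs"
  define c where "c = fact k / (fact CARD('n) :: real)"
  have c: "c > 0"
    by (simp add: c_def)
  have value_A: "polarized_vol (replicate k (A t) @ Ls d) = c * \<bar>t - d\<bar>" for t d
    using polarized_vol_slanted_box[OF pq, of t d] by (simp add: A_def Ls_def e_def c_def k del: replicate.simps)
  have norm_e: "norm (e d - e d') = \<bar>d - d'\<bar>" for d d'
    by (simp add: e_def scaleR_diff_left[symmetric] norm_axis_1)
  have e_le: "norm (e d) \<le> 2" if "0 \<le> d" "d \<le> 1" for d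
    unfolding e_def using norm_triangle_ineq[of "axis p (1::real)" "d *\<^sub>R axis q 1"] that
    by (simp add: norm_axis_1)
  define \<delta> where "\<delta> i = (1 / 4 :: real) ^ i" for i :: nat
  have \<delta>: "0 < \<delta> i" "\<delta> i \<le> 1" for i
    by (simp_all add: \<delta>_def power_le_one)
  define \<mu> where "\<mu> i K = 2 ^ i * (polarized_vol (replicate k K @ Ls 0) - polarized_vol (replicate k K @ Ls (\<delta> i)))"
    for i :: nat and K :: "(real^'n) convex_body"
  have \<mu>_Val: "\<mu> i \<in> Val k" for i
  proof -
    have "(\<lambda>K. polarized_vol (replicate k K @ Ls d)) \<in> Val k" for d
      using n by (intro polarized_vol_in_Val) (simp add: Ls_def)
    then have "2 ^ i *\<^sub>R ((\<lambda>K. polarized_vol (replicate k K @ Ls 0)) - (\<lambda>K. polarized_vol (replicate k K @ Ls (\<delta> i)))) \<in> Val k"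
      by (intro subspace_scale[OF subspace_Val] subspace_diff[OF subspace_Val])
    moreover have "2 ^ i *\<^sub>R ((\<lambda>K. polarized_vol (replicate k K @ Ls 0)) - (\<lambda>K. polarized_vol (replicate k K @ Ls (\<delta> i)))) = \<mu> i"
      by (simp add: fun_eq_iff scaleR_fun_def \<mu>_def)
    ultimately show ?thesis
      by simp
  qed
  have \<mu>_bound: "\<exists>C. summable C \<and> (\<forall>i K. body_set K \<subseteq> cball 0 R \<longrightarrow> \<bar>\<mu> i K\<bar> \<le> C i)" if "0 < R" for R
  proof -
    define S where "S = max R 2"
    have "0 \<le> S"
      by (simp add: S_def)
    then obtain C where C: "C \<ge> 0" "\<forall>Ks Ms :: (real^'n) convex_body list. length Ks = CARD('n) \<longrightarrow> length Ms = CARD('n) \<longrightarrow>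
        (\<forall>K\<in>set Ks \<union> set Ms. body_set K \<subseteq> cball 0 S) \<longrightarrow>
        \<bar>polarized_vol Ks - polarized_vol Ms\<bar> \<le> C * sum_list (map2 dist Ks Ms)"
      using polarized_vol_lipschitz[of S, where 'n = 'n] by blast
    have "\<bar>\<mu> i K\<bar> \<le> C * (1 / 2) ^ i" if K: "body_set K \<subseteq> cball 0 R" for i K
    proof -
      have sub: "body_set M \<subseteq> cball 0 S" if "M \<in> set (replicate k K @ Ls 0) \<union> set (replicate k K @ Ls (\<delta> i))" for M
      proof -
        have "cball 0 R \<subseteq> cball (0::real^'n) S"
          by (simp add: S_def subset_cball)
        moreover have "body_set (segment_body v) \<subseteq> cball 0 S" if "norm v \<le> 2" for v :: "real^'n"
          using that by (intro segment_body_subset_cball) (simp add: S_def)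
        moreover have "M = K \<or> M = segment_body (e 0) \<or> M = segment_body (e (\<delta> i)) \<or>
            (\<exists>j. M = segment_body (axis j 1))"
          using that by (auto simp: Ls_def)
        moreover have "norm (e 0) \<le> 2" "norm (e (\<delta> i)) \<le> 2" "norm (axis j 1 :: real^'n) \<le> 2" for j
          using e_le \<delta>[of i] by (simp_all add: norm_axis_1)
        ultimately show ?thesis
          using K by blast
      qed
      have dist_zero: "sum_list (map2 dist Ms Ms) = 0" for Ms :: "(real^'n) convex_body list"
        by (induction Ms) simp_all
      have "\<bar>polarized_vol (replicate k K @ Ls 0) - polarized_vol (replicate k K @ Ls (\<delta> i))\<bar> \<le>
          C * sum_list (map2 dist (replicate k K @ Ls 0) (replicate k K @ Ls (\<delta> i)))"
        by (rule C(2)[rule_format]) (use n sub in \<open>simp_all add: Ls_def\<close>)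
      also have "sum_list (map2 dist (replicate k K @ Ls 0) (replicate k K @ Ls (\<delta> i))) =
          dist (segment_body (e 0)) (segment_body (e (\<delta> i)))"
        by (simp add: Ls_def dist_zero sum_list_replicate)
      also have "C * \<dots> \<le> C * \<delta> i"
        using dist_segment_body[of "e 0" "e (\<delta> i)"] norm_e[of 0 "\<delta> i"] \<delta>[of i] C(1)
        by (intro mult_left_mono) auto
      finally have "\<bar>\<mu> i K\<bar> \<le> 2 ^ i * (C * \<delta> i)"
        unfolding \<mu>_def abs_mult by simp
      also have "\<dots> = C * (1 / 2) ^ i"
      proof -
        have "2 ^ i * \<delta> i = (2 * (1 / 4)) ^ i"
          unfolding \<delta>_def by (rule power_mult_distrib[symmetric])
        then show ?thesis
          by simp
      qed
      finally show ?thesis .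
    qed
    moreover have "summable (\<lambda>i. C * (1 / 2) ^ i)"
      by (intro summable_mult summable_geometric) simp
    ultimately show ?thesis
      by blast
  qed
  define \<phi> where "\<phi> K = (\<Sum>i. \<mu> i K)" for K
  have "\<phi> \<in> Val k" and summable: "summable (\<lambda>i. \<mu> i K)" for K
    unfolding \<phi>_def[abs_def] using suminf_in_Val[OF \<mu>_Val \<mu>_bound] by blast+
  moreover have "\<not> locally_lipschitz \<phi>"
  proof
    assume lip: "locally_lipschitz \<phi>"
    obtain r where r: "r > 0" "body_set (box_body (\<lambda>_. 1) cs :: (real^'n) convex_body) \<subseteq> cball 0 r"
      using body_subset_cball by blast
    then have "0 \<le> 2 + r"
      by simp
    then obtain C where C: "\<forall>K L. body_set K \<subseteq> cball 0 (2 + r) \<longrightarrow> body_set L \<subseteq> cball 0 (2 + r) \<longrightarrow>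
        \<bar>\<phi> K - \<phi> L\<bar> \<le> C * dist K L"
      using lip unfolding locally_lipschitz_def by blast
    have A_sub: "body_set (A t) \<subseteq> cball 0 (2 + r)" if "0 \<le> t" "t \<le> 1" for t
      unfolding A_def slanted_box_def e_def[symmetric]
      by (intro body_set_plus_subset_cball segment_body_subset_cball e_le that r(2))
    have growth: "2 ^ j * (2 * c) \<le> C" for j
    proof -
      \<comment> \<open>the increment of the i-th term along the family A, which is nonnegative by the triangle inequality\<close>
      define f where "f i = \<mu> i (A (\<delta> j)) - \<mu> i (A 0)" for i
      have f: "f i = 2 ^ i * (c * (\<delta> j - \<bar>\<delta> j - \<delta> i\<bar> + \<delta> i))" for i
        using \<delta>[of i] \<delta>[of j] unfolding f_def \<mu>_def value_A by (simp add: algebra_simps)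
      have "0 \<le> f i" for i
        unfolding f using \<delta>[of i] \<delta>[of j] c by (intro mult_nonneg_nonneg) auto
      moreover have "summable f"
        unfolding f_def[abs_def] by (intro summable_diff summable)
      ultimately have "f j \<le> suminf f"
        using sum_le_suminf[of f "{j}"] by simp
      also have "\<dots> = \<phi> (A (\<delta> j)) - \<phi> (A 0)"
        unfolding f_def[abs_def] \<phi>_def by (rule suminf_diff[symmetric]; rule summable)
      also have "\<dots> \<le> C * dist (A (\<delta> j)) (A 0)"
        using C A_sub[of "\<delta> j"] A_sub[of 0] \<delta>[of j] by (force simp: abs_le_iff)
      finally have le: "2 ^ j * (c * (2 * \<delta> j)) \<le> C * dist (A (\<delta> j)) (A 0)"
        by (simp add: f)
      have "dist (A (\<delta> j)) (A 0) \<le> dist (segment_body (e (\<delta> j))) (segment_body (e 0)) + dist (box_body (\<lambda>_. 1) cs) (box_body (\<lambda>_. 1) cs)"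
        unfolding A_def slanted_box_def e_def[symmetric] by (rule body_dist_add)
      also have "\<dots> \<le> \<delta> j"
        using dist_segment_body[of "e (\<delta> j)" "e 0"] norm_e[of "\<delta> j" 0] \<delta>[of j] by simp
      finally have dist: "dist (A (\<delta> j)) (A 0) \<le> \<delta> j" .
      have "0 < 2 ^ j * (c * (2 * \<delta> j))"
        using c \<delta>[of j] by simp
      then have "0 < C * dist (A (\<delta> j)) (A 0)"
        using le by linarith
      then have "0 \<le> C"
        by (simp add: zero_less_mult_iff)
      then have "C * dist (A (\<delta> j)) (A 0) \<le> C * \<delta> j"
        using dist by (rule mult_left_mono[rotated])
      with le have "(2 ^ j * (2 * c)) * \<delta> j \<le> C * \<delta> j"
        by (simp add: ac_simps)
      then show ?thesis
        using \<delta>[of j] by simp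
    qed
    obtain j where "C / (2 * c) < 2 ^ j"
      using real_arch_pow[of 2 "C / (2 * c)"] by auto
    with growth[of j] c show False
      by (simp add: field_simps)
  qed
  ultimately show ?thesis
    by blast
qed

section \<open>The span of the mixed volumes\<close>

theorem corollary4p4:
  fixes k :: nat
  assumes "CARD('n::finite) \<ge> 2" and "1 \<le> k" and "k \<le> CARD('n) - 1"
  shows "span {\<lambda>K. mixed_volume (replicate k K @ Ls) | Ls :: (real ^ 'n) convex_body list.
      length Ls = CARD('n) - k} \<subset> Val k"
    (is "span ?S \<subset> _")
proof (rule psubsetI)
  have S: "\<mu> \<in> Val k \<and> locally_lipschitz \<mu>" if mem: "\<mu> \<in> ?S" for \<mu>
  proof -
    obtain Ls :: "(real^'n) convex_body list"
      where Ls: "\<mu> = (\<lambda>K. mixed_volume (replicate k K @ Ls))" "length Ls = CARD('n) - k"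
      using mem by blast
    then have n: "k + length Ls = CARD('n)"
      using assms by simp
    then have "\<mu> = (\<lambda>K. polarized_vol (replicate k K @ Ls))"
      unfolding Ls(1) by (intro ext mixed_volume_eq_polarized_vol) simp
    then show ?thesis
      using polarized_vol_in_Val[OF n] locally_lipschitz_polarized_vol[OF n] by simp
  qed
  show "span ?S \<subseteq> Val k"
    using S by (intro span_minimal subspace_Val) blast
  have "span ?S \<subseteq> {\<mu>. locally_lipschitz \<mu>}"
    using S by (intro span_minimal subspace_locally_lipschitz) blast
  then show "span ?S \<noteq> Val k"
    using non_lipschitz_in_Val[OF assms] by blast
qed

end
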